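(* For any two $n \times n$ matrices $A$ and $B$ and $0 < \epsilon \leq 2$, $A \star B$ can be computed by a MapReduce algorithm with $n^{3(1-\epsilon/2)}$ machines and memory $O(n^{\epsilon})$ per machine in $1+\lceil (1-\epsilon/2)/\epsilon\rceil$ MapReduce rounds. Moreover, the total running time of the algorithm is $O(\epsilon^{-1} n^3)$.
   Context: For an $n\times m$ matrix $A$ and an $m\times p$ matrix $B$, the $(\min,+)$ (distance) product $C=A\star B$ is the $n\times p$ matrix with $c_{i,j}=\min_{k\in[m]}(a_{i,k}+b_{k,j})$. MapReduce model: computation proceeds in synchronous rounds; in each round every machine performs arbitrary local computation on its local memory and then machines exchange data (each machine sends/receives at most its memory); the input is initially distributed among machines; memory counts words stored per machine; total running time is summed over all machines. *)

theory Defs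
  imports Complex_Main "Jordan_Normal_Form.Matrix"
begin

section \<open>The distance product\<close>

definition dist_prod ::
  "'a :: linordered_ab_semigroup_add mat \<Rightarrow> 'a mat \<Rightarrow> 'a mat"  (infixl \<open>\<star>\<close> 70) where
  "A \<star> B = mat (dim_row A) (dim_col B)
     (\<lambda>(i, j). MIN k\<in>{..<dim_col A}. A $$ (i, k) + B $$ (k, j))"


section \<open>Local computation: a unit-cost word RAM\<close>

text \<open>
  A memory word holds either a number or a matrix entry. Entries are opaque: they can be moved,
  added and compared, so no information can be packed into them. Numbers may not exceed a bound
  \<open>W\<close>, instantiated below by a fixed power of \<open>n + 1\<close>, so a number has \<open>O(log n)\<close> bits.
\<close>

datatype 'a word = Num nat | Entry 'a

datatype oper = Add | Sub | Mult | Div | Mod | Less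

datatype expr = Const nat | Mem expr | Op oper expr expr

text \<open>
  All data of a machine, program variables included, live in one memory with cells
  \<open>0, \<dots>, S - 1\<close>; accessing any other cell is an error. \<open>Send d a e\<close> puts the value of \<open>e\<close> into the
  outbox, addressed to cell \<open>a\<close> of machine \<open>d\<close>.
\<close>

datatype com =
    Skip
  | Store expr expr
  | Send expr expr expr
  | Seq com com
  | If expr com com
  | While expr com

type_synonym 'a memory = "nat \<Rightarrow> 'a word"
type_synonym 'a message = "nat \<times> nat \<times> 'a word"

definition num_word :: "nat \<Rightarrow> nat \<Rightarrow> 'a word option" where
  "num_word W x = (if x \<le> W then Some (Num x) else None)"

fun apply_op ::
  "nat \<Rightarrow> oper \<Rightarrow> 'a :: linordered_ab_semigroup_add word \<Rightarrow> 'a word \<Rightarrow> 'a word option" where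
  "apply_op W Add (Num x) (Num y) = num_word W (x + y)"
| "apply_op W Sub (Num x) (Num y) = num_word W (x - y)"
| "apply_op W Mult (Num x) (Num y) = num_word W (x * y)"
| "apply_op W Div (Num x) (Num y) = num_word W (x div y)"
| "apply_op W Mod (Num x) (Num y) = num_word W (x mod y)"
| "apply_op W Less (Num x) (Num y) = num_word W (if x < y then 1 else 0)"
| "apply_op W Add (Entry x) (Entry y) = Some (Entry (x + y))"
| "apply_op W Less (Entry x) (Entry y) = num_word W (if x < y then 1 else 0)"
| "apply_op W _ _ _ = None"

fun eval ::
  "nat \<Rightarrow> nat \<Rightarrow> 'a :: linordered_ab_semigroup_add memory \<Rightarrow> expr \<Rightarrow> 'a word option" where
  "eval S W m (Const c) = num_word W c"
| "eval S W m (Mem e) =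
     (case eval S W m e of
        Some (Num a) \<Rightarrow> if a < S then Some (m a) else None
      | _ \<Rightarrow> None)"
| "eval S W m (Op f e1 e2) =
     (case (eval S W m e1, eval S W m e2) of
        (Some v, Some w) \<Rightarrow> apply_op W f v w
      | _ \<Rightarrow> None)"

fun cost :: "expr \<Rightarrow> nat" where
  "cost (Const c) = 1"
| "cost (Mem e) = 1 + cost e"
| "cost (Op f e1 e2) = 1 + cost e1 + cost e2"

text \<open>
  \<open>exec S W c (m, out) t (m', out')\<close>: started with memory \<open>m\<close> and outbox \<open>out\<close>, the program \<open>c\<close>
  halts without error after \<open>t\<close> steps. A run-time error or divergence means that there is no
  derivation.
\<close>

inductive exec ::
  "nat \<Rightarrow> nat \<Rightarrow> com \<Rightarrow> 'a :: linordered_ab_semigroup_add memory \<times> 'a message list \<Rightarrow> nat \<Rightarrow>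
   'a memory \<times> 'a message list \<Rightarrow> bool"
  for S W :: nat where
  exec_Skip: "exec S W Skip s 1 s"
| exec_Store: "eval S W m e1 = Some (Num a) \<Longrightarrow> a < S \<Longrightarrow> eval S W m e2 = Some v \<Longrightarrow>
    exec S W (Store e1 e2) (m, out) (1 + cost e1 + cost e2) (m(a := v), out)"
| exec_Send: "eval S W m e1 = Some (Num d) \<Longrightarrow> eval S W m e2 = Some (Num a) \<Longrightarrow>
    eval S W m e3 = Some v \<Longrightarrow>
    exec S W (Send e1 e2 e3) (m, out) (1 + cost e1 + cost e2 + cost e3) (m, out @ [(d, a, v)])"
| exec_Seq: "exec S W c1 s1 t1 s2 \<Longrightarrow> exec S W c2 s2 t2 s3 \<Longrightarrow>
    exec S W (Seq c1 c2) s1 (t1 + t2) s3"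
| exec_If: "eval S W (fst s) e = Some (Num b) \<Longrightarrow>
    exec S W (if b \<noteq> 0 then c1 else c2) s t s' \<Longrightarrow>
    exec S W (If e c1 c2) s (1 + cost e + t) s'"
| exec_While_False: "eval S W (fst s) e = Some (Num 0) \<Longrightarrow>
    exec S W (While e c) s (1 + cost e) s"
| exec_While_True: "eval S W (fst s1) e = Some (Num b) \<Longrightarrow> b \<noteq> 0 \<Longrightarrow>
    exec S W c s1 t1 s2 \<Longrightarrow> exec S W (While e c) s2 t2 s3 \<Longrightarrow>
    exec S W (While e c) s1 (1 + cost e + t1 + t2) s3"


section \<open>MapReduce rounds\<close>

definition inbox :: "nat \<Rightarrow> (nat \<Rightarrow> 'a message list) \<Rightarrow> nat \<Rightarrow> (nat \<times> 'a word) list" where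
  "inbox p out j = map snd (filter (\<lambda>msg. fst msg = j) (concat (map out [0..<p])))"

definition deliver :: "'a memory \<Rightarrow> (nat \<times> 'a word) list \<Rightarrow> 'a memory" where
  "deliver m msgs = (\<lambda>a. case map_of msgs a of None \<Rightarrow> m a | Some v \<Rightarrow> v)"

text \<open>
  The exchange is legal if every machine sends and receives at most \<open>S\<close> words, all destinations
  exist, and no cell is the destination of two messages.
\<close>

definition legal_exchange :: "nat \<Rightarrow> nat \<Rightarrow> (nat \<Rightarrow> 'a message list) \<Rightarrow> bool" where
  "legal_exchange p S out \<longleftrightarrow>
     (\<forall>i<p. length (out i) \<le> S \<and> (\<forall>(d, a, v)\<in>set (out i). d < p \<and> a < S)) \<and>
     (\<forall>j<p. length (inbox p out j) \<le> S \<and> distinct (map fst (inbox p out j)))"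

text \<open>
  One round on \<open>p\<close> machines with memory \<open>S\<close>, of total running time \<open>t\<close>. In every round all
  machines run the same program from its beginning, each on its own memory.
\<close>

definition mr_round ::
  "nat \<Rightarrow> nat \<Rightarrow> nat \<Rightarrow> com \<Rightarrow> (nat \<Rightarrow> 'a :: linordered_ab_semigroup_add memory) \<Rightarrow> nat \<Rightarrow>
   (nat \<Rightarrow> 'a memory) \<Rightarrow> bool" where
  "mr_round p S W c M t M' \<longleftrightarrow>
     (\<exists>M1 out time.
        (\<forall>i<p. exec S W c (M i, []) (time i) (M1 i, out i)) \<and>
        legal_exchange p S out \<and>
        (\<forall>j<p. M' j = deliver (M1 j) (inbox p out j)) \<and>
        t = (\<Sum>i<p. time i))"

inductive mr_run ::
  "nat \<Rightarrow> nat \<Rightarrow> nat \<Rightarrow> com \<Rightarrow> nat \<Rightarrow> (nat \<Rightarrow> 'a :: linordered_ab_semigroup_add memory) \<Rightarrow> nat \<Rightarrow>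
   (nat \<Rightarrow> 'a memory) \<Rightarrow> bool"
  for p S W :: nat and c :: com where
  mr_run_0: "mr_run p S W c 0 M 0 M"
| mr_run_Suc: "mr_round p S W c M1 t1 M2 \<Longrightarrow> mr_run p S W c R M2 t2 M3 \<Longrightarrow>
    mr_run p S W c (Suc R) M1 (t1 + t2) M3"


section \<open>Computing a distance product\<close>

datatype source = FromA nat nat | FromB nat nat

text \<open>
  \<open>lay i a\<close> is the input entry initially held in cell \<open>a\<close> of machine \<open>i\<close>, if any. The placement
  does not depend on the values of the entries; the same entry may be placed on several machines.
  Cells 0 to 2 are reserved for the machine's number, the dimension \<open>n\<close> and the number \<open>p\<close> of
  machines, which must be representable.
\<close>

type_synonym placement = "nat \<Rightarrow> nat \<Rightarrow> source option"

definition valid_placement :: "nat \<Rightarrow> nat \<Rightarrow> nat \<Rightarrow> nat \<Rightarrow> placement \<Rightarrow> bool" where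
  "valid_placement n p S W lay \<longleftrightarrow>
     3 \<le> S \<and> n \<le> W \<and> p \<le> W \<and>
     (\<forall>i<p. \<forall>a. case lay i a of
        None \<Rightarrow> True
      | Some (FromA x y) \<Rightarrow> 3 \<le> a \<and> a < S \<and> x < n \<and> y < n
      | Some (FromB x y) \<Rightarrow> 3 \<le> a \<and> a < S \<and> x < n \<and> y < n)"

definition init_mem :: "nat \<Rightarrow> nat \<Rightarrow> placement \<Rightarrow> 'a mat \<Rightarrow> 'a mat \<Rightarrow> nat \<Rightarrow> 'a memory" where
  "init_mem n p lay A B i a =
     (if a = 0 then Num i else if a = 1 then Num n else if a = 2 then Num p
      else case lay i a of
        None \<Rightarrow> Num 0
      | Some (FromA x y) \<Rightarrow> Entry (A $$ (x, y))
      | Some (FromB x y) \<Rightarrow> Entry (B $$ (x, y)))"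

text \<open>
  After the last round, entry \<open>(x, y)\<close> of the result must be in cell \<open>snd (loc x y)\<close> of machine
  \<open>fst (loc x y)\<close>; like the input placement, \<open>loc\<close> does not depend on the entries.
\<close>

definition holds_result ::
  "nat \<Rightarrow> nat \<Rightarrow> (nat \<Rightarrow> nat \<Rightarrow> nat \<times> nat) \<Rightarrow> 'a mat \<Rightarrow> (nat \<Rightarrow> 'a memory) \<Rightarrow> bool" where
  "holds_result p S loc D M \<longleftrightarrow>
     (\<forall>x<dim_row D. \<forall>y<dim_col D. fst (loc x y) < p \<and> snd (loc x y) < S \<and>
        M (fst (loc x y)) (snd (loc x y)) = Entry (D $$ (x, y)))"


section \<open>Determinism of local computation\<close>

inductive_cases exec_SkipE: "exec S W Skip s t s'"
inductive_cases exec_StoreE: "exec S W (Store e1 e2) s t s'"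
inductive_cases exec_SendE: "exec S W (Send e1 e2 e3) s t s'"
inductive_cases exec_SeqE: "exec S W (Seq c1 c2) s t s'"
inductive_cases exec_IfE: "exec S W (If e c1 c2) s t s'"
inductive_cases exec_WhileE: "exec S W (While e c) s t s'"

lemma exec_deterministic:
  assumes "exec S W c s t s'" "exec S W c s u s''"
  shows "u = t \<and> s'' = s'"
  using assms
proof (induction arbitrary: u s'' rule: exec.induct)
  case (exec_Skip s) show ?case using exec_Skip.prems by (auto elim: exec_SkipE)
next
  case (exec_Store m e1 a e2 v out)
  show ?case using exec_Store.prems exec_Store.hyps by (auto elim!: exec_StoreE)
next
  case (exec_Send m e1 d e2 a e3 v out)
  show ?case using exec_Send.prems exec_Send.hyps by (auto elim!: exec_SendE)
next
  case (exec_Seq c1 s1 t1 s2 c2 t2 s3)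
  show ?case by (rule exec_SeqE[OF exec_Seq.prems]) (use exec_Seq.IH in blast)
next
  case (exec_If s e b c1 c2 t s')
  show ?case
  proof (rule exec_IfE[OF exec_If.prems], goal_cases)
    case (1 b' t')
    have "b' = b" using 1(2) exec_If.hyps(1) by simp
    then have "exec S W (if b \<noteq> 0 then c1 else c2) s t' s''" using 1(3) by simp
    from exec_If.IH[OF this] 1(1) show ?case by simp
  qed
next
  case (exec_While_False s e c)
  show ?case
  proof (rule exec_WhileE[OF exec_While_False.prems], goal_cases)
    case 1 then show ?case by simp
  next
    case (2 b t1 s2 t2) with exec_While_False.hyps show ?case by simp
  qed
next
  case (exec_While_True s1 e b c t1 s2 t2 s3)
  show ?case
  proof (rule exec_WhileE[OF exec_While_True.prems], goal_cases)
    case 1 with exec_While_True.hyps show ?case by simp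
  next
    case (2 b' t1' s2' t2')
    have "t1' = t1 \<and> s2' = s2" using exec_While_True.IH(1)[OF 2(4)] .
    with exec_While_True.IH(2)[of t2' s''] 2(1,5) show ?case by simp
  qed
qed

end

theory Submission
  imports Defs
begin

text \<open>
  Let \<open>q\<close> be the largest power of 2 with \<open>q\<^sup>3 \<le> p\<close> and \<open>b\<close> the smallest power of 2 with \<open>n \<le> q b\<close>, so that
  \<open>b\<close> is \<open>n powr (\<epsilon> / 2)\<close> up to a constant factor. Machine \<open>(i q + j) q + k\<close> multiplies block \<open>(i, k)\<close> of
  \<open>A\<close> by block \<open>(k, j)\<close> of \<open>B\<close>; these \<open>b\<close> by \<open>b\<close> blocks fit into its memory. The minimum over the
  \<open>q\<close> values of \<open>k\<close> is taken along a tree of fan-in \<open>f = b\<^sup>2 \<ge> n powr \<epsilon>\<close>, one level per round: the machines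
  of a group share the \<open>f\<close> positions of the block among themselves, so no machine ever receives more
  than \<open>O(f)\<close> values. As \<open>q \<le> n powr (1 - \<epsilon> / 2)\<close>, the claimed number of rounds suffices. Every round costs
  \<open>O(b\<^sup>3)\<close> per machine. Finding \<open>q\<close> and \<open>b\<close> by doubling costs \<open>O(log n)\<close>, which is affordable because it
  is done only once and \<open>ln n = O(\<epsilon>\<^sup>-\<^sup>1 n powr (\<epsilon> / 2))\<close>.
\<close>

section \<open>Running time of programs\<close>

text \<open>The program is one fixed text, restarted in every round. It sees its machine number,
  \<open>n\<close> and \<open>p\<close>, but neither \<epsilon> nor the round number, so
  \<open>q\<close> and \<open>b\<close> must be recovered from \<open>n\<close> and
  \<open>p\<close>, and the memory itself must tell which phase comes next. An ordinary tree would
  fail on memory: collecting \<open>f\<close> whole blocks at one machine takes \<open>f * f\<close>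
  cells. Splitting the positions more finely as groups grow avoids this, but correct addressing then
  needs each group size to divide the next one and finally \<open>q\<close>. Powers of two guarantee
  this even at the last level, where the growth by the factor \<open>f\<close> is cut off at
  \<open>q\<close>. The number of rounds is exact, while memory and time tolerate constant factors.
  So all rounding goes one way: \<open>q\<close> is rounded down and \<open>b\<close> up. This can
  only shorten the tree, and the price is a constant factor in block size.\<close>

text \<open>The postcondition also receives the unspent part of the time budget \<open>T\<close>.\<close>

definition run ::
  "nat \<Rightarrow> nat \<Rightarrow> com \<Rightarrow> 'a :: linordered_ab_semigroup_add memory \<times> 'a message list \<Rightarrow> nat \<Rightarrow>
   ('a memory \<times> 'a message list \<Rightarrow> nat \<Rightarrow> bool) \<Rightarrow> bool" where
  "run S W c s T Q \<longleftrightarrow> (\<exists>t s'. exec S W c s t s' \<and> t \<le> T \<and> Q s' (T - t))"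

lemma run_Skip: "1 \<le> T \<Longrightarrow> Q s (T - 1) \<Longrightarrow> run S W Skip s T Q"
  unfolding run_def by (blast intro: exec_Skip)

lemma run_Store:
  assumes "eval S W m e1 = Some (Num a)" "a < S" "eval S W m e2 = Some v"
    "1 + cost e1 + cost e2 \<le> T" "Q (m(a := v), out) (T - (1 + cost e1 + cost e2))"
  shows "run S W (Store e1 e2) (m, out) T Q"
  unfolding run_def using exec_Store[OF assms(1-3)] assms(4,5) by blast

lemma run_Send:
  assumes "eval S W m e1 = Some (Num d)" "eval S W m e2 = Some (Num a)" "eval S W m e3 = Some v"
    "1 + cost e1 + cost e2 + cost e3 \<le> T"
    "Q (m, out @ [(d, a, v)]) (T - (1 + cost e1 + cost e2 + cost e3))"
  shows "run S W (Send e1 e2 e3) (m, out) T Q"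
  unfolding run_def using exec_Send[OF assms(1-3)] assms(4,5) by blast

text \<open>The second program is verified under whatever budget the first one leaves over, so no
  split of \<open>T\<close> has to be named in advance.\<close>

lemma run_Seq:
  assumes "run S W c1 s T (\<lambda>s' T'. run S W c2 s' T' Q)"
  shows "run S W (Seq c1 c2) s T Q"
proof -
  from assms obtain t1 s1 t2 s2 where
    "exec S W c1 s t1 s1" "t1 \<le> T" "exec S W c2 s1 t2 s2" "t2 \<le> T - t1" "Q s2 (T - t1 - t2)"
    unfolding run_def by blast
  then have "exec S W (Seq c1 c2) s (t1 + t2) s2" "t1 + t2 \<le> T" "Q s2 (T - (t1 + t2))"
    by (auto intro: exec_Seq)
  then show ?thesis unfolding run_def by blast
qed

lemma run_If:
  assumes "eval S W (fst s) e = Some (Num v)" "1 + cost e \<le> T"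
    "v \<noteq> 0 \<Longrightarrow> run S W c1 s (T - (1 + cost e)) Q"
    "v = 0 \<Longrightarrow> run S W c2 s (T - (1 + cost e)) Q"
  shows "run S W (If e c1 c2) s T Q"
proof -
  have "run S W (if v \<noteq> 0 then c1 else c2) s (T - (1 + cost e)) Q"
    using assms(3,4) by simp
  then obtain t s' where "exec S W (if v \<noteq> 0 then c1 else c2) s t s'"
    "t \<le> T - (1 + cost e)" "Q s' (T - (1 + cost e) - t)"
    unfolding run_def by blast
  then have "exec S W (If e c1 c2) s (1 + cost e + t) s'" "1 + cost e + t \<le> T"
    "Q s' (T - (1 + cost e + t))"
    using exec_If[OF assms(1)] assms(2) by auto
  then show ?thesis unfolding run_def by blast
qed

text \<open>Embeds a stand-alone specification with its own budget \<open>T'\<close> into a larger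
  program. As \<open>c\<close> may stop early, the budget left afterwards is known only from
  below.\<close>

lemma run_conseq:
  assumes "run S W c s T' (\<lambda>s' _. P s')" "T' \<le> T"
    "\<And>s' r. P s' \<Longrightarrow> T - T' \<le> r \<Longrightarrow> Q s' r"
  shows "run S W c s T Q"
proof -
  from assms(1) obtain t s' where "exec S W c s t s'" "t \<le> T'" "P s'"
    unfolding run_def by blast
  moreover have "Q s' (T - t)" using assms(3)[OF \<open>P s'\<close>] \<open>t \<le> T'\<close> by auto
  ultimately show ?thesis unfolding run_def using assms(2) by (meson le_trans)
qed

text \<open>The invariant is indexed by the number of completed iterations and alone decides the
  guard. The loop therefore runs exactly \<open>N - i\<close> more times, and termination comes with
  the induction.\<close>

lemma run_While_aux:
  assumes body: "\<And>i s. i < N \<Longrightarrow> P i s \<Longrightarrow>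
      (\<exists>v. eval S W (fst s) e = Some (Num v) \<and> v \<noteq> 0) \<and> run S W c s Tb (\<lambda>s' _. P (Suc i) s')"
    and exit: "\<And>s. P N s \<Longrightarrow> eval S W (fst s) e = Some (Num 0)"
    and "P i s" "i \<le> N"
  shows "run S W (While e c) s ((N - i) * (1 + cost e + Tb) + 1 + cost e) (\<lambda>s' _. P N s')"
  using \<open>P i s\<close> \<open>i \<le> N\<close>
proof (induction "N - i" arbitrary: i s)
  case 0
  then have "exec S W (While e c) s (1 + cost e) s"
    using exec_While_False[OF exit[of s]] by simp
  then show ?case unfolding run_def using 0 by fastforce
next
  case (Suc k)
  then have i: "i < N" by simp
  obtain v where v: "eval S W (fst s) e = Some (Num v)" "v \<noteq> 0"
    using body[OF i Suc.prems(1)] by blast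
  obtain t s' where s': "exec S W c s t s'" "t \<le> Tb" "P (Suc i) s'"
    using body[OF i Suc.prems(1)] unfolding run_def by blast
  have "run S W (While e c) s' ((N - Suc i) * (1 + cost e + Tb) + 1 + cost e) (\<lambda>s' _. P N s')"
    using Suc(1)[of "Suc i" s'] Suc(2) i s'(3) by simp
  then obtain t' s'' where s'': "exec S W (While e c) s' t' s''"
    "t' \<le> (N - Suc i) * (1 + cost e + Tb) + 1 + cost e" "P N s''"
    unfolding run_def by blast
  have "exec S W (While e c) s (1 + cost e + t + t') s''"
    by (rule exec_While_True[OF v s'(1) s''(1)])
  moreover have "1 + cost e + t + t' \<le> (N - i) * (1 + cost e + Tb) + 1 + cost e"
  proof -
    have "N - i = Suc (N - Suc i)" using i by simp
    then show ?thesis using s'(2) s''(2) by simp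
  qed
  ultimately show ?case unfolding run_def using s''(3) by blast
qed

lemma run_While:
  assumes "P 0 s"
    and "\<And>i s. i < N \<Longrightarrow> P i s \<Longrightarrow>
      (\<exists>v. eval S W (fst s) e = Some (Num v) \<and> v \<noteq> 0) \<and> run S W c s Tb (\<lambda>s' _. P (Suc i) s')"
    and "\<And>s. P N s \<Longrightarrow> eval S W (fst s) e = Some (Num 0)"
    and "N * (1 + cost e + Tb) + 1 + cost e \<le> T"
    and "\<And>s' r. P N s' \<Longrightarrow> T - (N * (1 + cost e + Tb) + 1 + cost e) \<le> r \<Longrightarrow> Q s' r"
  shows "run S W (While e c) s T Q"
  using run_conseq[OF run_While_aux[where P = P and i = 0 and N = N and Tb = Tb,
        OF assms(2,3,1) le0] _ assms(5)] assms(4)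
  by simp

section \<open>Loops that compute minima\<close>

abbreviation cell :: "nat \<Rightarrow> expr" where "cell x \<equiv> Mem (Const x)"

text \<open>Entries come without a top element to start from, so the value at index 0 is stored
  first and the loop begins at 1. \<open>bnd\<close> is the number of the cell that holds the bound;
  \<open>src\<close> is re-evaluated with the running index in cell 10; the target is addressed
  indirectly through cell 11.\<close>

definition min_loop :: "nat \<Rightarrow> expr \<Rightarrow> com" where
  "min_loop bnd src =
    Seq (Store (Const 10) (Const 0))
   (Seq (Store (cell 11) src)
   (Seq (Store (Const 10) (Const 1))
        (While (Op Less (cell 10) (cell bnd))
          (Seq (If (Op Less src (Mem (cell 11))) (Store (cell 11) src) Skip)
               (Store (Const 10) (Op Add (cell 10) (Const 1)))))))"

lemma Min_lessThan_Suc: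
  fixes g :: "nat \<Rightarrow> 'a :: linorder"
  assumes "0 < w"
  shows "(MIN v\<in>{..<Suc w}. g v) = (if g w < (MIN v\<in>{..<w}. g v) then g w else (MIN v\<in>{..<w}. g v))"
proof -
  have "(MIN v\<in>{..<Suc w}. g v) = min (g w) (MIN v\<in>{..<w}. g v)"
    using assms by (auto simp: lessThan_Suc lessThan_empty_iff intro!: Min_insert)
  then show ?thesis by (auto simp: min_def)
qed

text \<open>The hypothesis on \<open>src\<close> ranges over all memories that differ from
  \<open>m\<close> only in the index cell and the target, so the source cannot depend on the
  unfinished minimum. The factor 2 pays for evaluating \<open>src\<close> in the comparison and
  again in the store.\<close>

lemma run_min_loop:
  fixes m :: "'a :: linordered_ab_semigroup_add memory"
  assumes S: "16 \<le> S" "16 \<le> W" and d: "m 11 = Num d" "16 \<le> d" "d < S"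
    and N: "bnd < 10" "m bnd = Num N" "0 < N" "N \<le> W"
    and src: "\<And>m' w. w < N \<Longrightarrow> (\<And>a. a \<noteq> 10 \<Longrightarrow> a \<noteq> d \<Longrightarrow> m' a = m a) \<Longrightarrow> m' 10 = Num w \<Longrightarrow>
        eval S W m' src = Some (Entry (g w))"
  shows "run S W (min_loop bnd src) (m, out) (N * (30 + 2 * cost src))
    (\<lambda>s' _. case s' of (m', out') \<Rightarrow> out' = out \<and> m' d = Entry (MIN w\<in>{..<N}. g w) \<and>
       (\<forall>a. a \<noteq> 10 \<longrightarrow> a \<noteq> d \<longrightarrow> m' a = m a))"
proof -
  define T where "T = N * (30 + 2 * cost src)"
  \<comment> \<open>One of the \<open>N\<close> shares covers the value at index 0 and the exit
    test, leaving \<open>N - 1\<close> iterations.\<close>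
  have T: "T = (N - 1) * (30 + 2 * cost src) + 30 + 2 * cost src"
    using \<open>0 < N\<close> by (cases N) (auto simp: T_def algebra_simps)
  define P where "P = (\<lambda>i (m', out'). out' = out \<and> m' 10 = Num (Suc i) \<and>
    m' d = Entry (MIN w\<in>{..<Suc i}. g w) \<and> (\<forall>a. a \<noteq> 10 \<longrightarrow> a \<noteq> d \<longrightarrow> m' a = m a))"
  define m1 where "m1 = m(10 := Num 0)"
  have src1: "eval S W m1 src = Some (Entry (g 0))"
    by (rule src) (use N in \<open>auto simp: m1_def\<close>)
  let ?while = "While (Op Less (cell 10) (cell bnd))
          (Seq (If (Op Less src (Mem (cell 11))) (Store (cell 11) src) Skip)
               (Store (Const 10) (Op Add (cell 10) (Const 1))))"
  define m2 where "m2 = m1(d := Entry (g 0), 10 := Num 1)"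
  have loop: "run S W ?while (m2, out) T' (\<lambda>s' _. case s' of (m', out') \<Rightarrow> out' = out \<and>
       m' d = Entry (MIN w\<in>{..<N}. g w) \<and> (\<forall>a. a \<noteq> 10 \<longrightarrow> a \<noteq> d \<longrightarrow> m' a = m a))"
    if T': "(N - 1) * (30 + 2 * cost src) + 10 \<le> T'" for T'
  proof (rule run_While[where P = P and N = "N - 1" and Tb = "20 + 2 * cost src"])
    show "P 0 (m2, out)" using d by (auto simp: P_def m2_def m1_def lessThan_Suc)
  next
    fix i s assume i: "i < N - 1" and "P i s"
    then obtain m' where s: "s = (m', out)" and m': "m' 10 = Num (Suc i)"
      "m' d = Entry (MIN w\<in>{..<Suc i}. g w)" "\<And>a. a \<noteq> 10 \<Longrightarrow> a \<noteq> d \<Longrightarrow> m' a = m a"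
      by (auto simp: P_def)
    have ev: "eval S W m' src = Some (Entry (g (Suc i)))"
      by (rule src) (use i m' in auto)
    have c: "m' bnd = Num N" "m' 11 = Num d" using m'(3)[of bnd] m'(3)[of 11] N d by auto
    have g1: "eval S W (fst s) (Op Less (cell 10) (cell bnd)) = Some (Num 1)"
      using S N(1) c m'(1) i by (simp add: s num_word_def)
    let ?lt = "g (Suc i) < (MIN w\<in>{..<Suc i}. g w)"
    have e2: "eval S W m' (Op Less src (Mem (cell 11))) = Some (Num (if ?lt then 1 else 0))"
      using S d c m'(2) by (simp add: ev num_word_def)
    have step: "run S W (Store (Const 10) (Op Add (cell 10) (Const 1))) (m'', out) T'' (\<lambda>s' _. P (Suc i) s')"
      if m'': "m'' 10 = Num (Suc i)" "m'' d = Entry (MIN w\<in>{..<Suc (Suc i)}. g w)"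
          "\<And>a. a \<noteq> 10 \<Longrightarrow> a \<noteq> d \<Longrightarrow> m'' a = m a" "6 \<le> T''" for m'' T''
      by (rule run_Store[where a = 10 and v = "Num (Suc (Suc i))"])
         (use S N i m'' d in \<open>auto simp: num_word_def P_def\<close>)
    have "run S W (Seq (If (Op Less src (Mem (cell 11))) (Store (cell 11) src) Skip)
               (Store (Const 10) (Op Add (cell 10) (Const 1)))) s
          (20 + 2 * cost src) (\<lambda>s' _. P (Suc i) s')"
      unfolding s
    proof (rule run_Seq, rule run_If)
      show "eval S W (fst (m', out)) (Op Less src (Mem (cell 11))) = Some (Num (if ?lt then 1 else 0))"
        using e2 by simp
    next
      assume "(if ?lt then 1 else 0 :: nat) \<noteq> 0"
      then have lt: ?lt by (simp split: if_splits)
      show "run S W (Store (cell 11) src) (m', out) (20 + 2 * cost src - (1 + cost (Op Less src (Mem (cell 11)))))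
         (\<lambda>s' T'. run S W (Store (Const 10) (Op Add (cell 10) (Const 1))) s' T' (\<lambda>s' _. P (Suc i) s'))"
        apply (rule run_Store[where a = d, OF _ _ ev])
        subgoal using S c d by (simp add: num_word_def)
        subgoal using d by simp
        subgoal by simp
        subgoal by (rule step) (use lt m' d in \<open>auto simp: Min_lessThan_Suc[of "Suc i"]\<close>)
        done
    next
      assume "(if ?lt then 1 else 0 :: nat) = 0"
      then have lt: "\<not> ?lt" by (simp split: if_splits)
      show "run S W Skip (m', out) (20 + 2 * cost src - (1 + cost (Op Less src (Mem (cell 11)))))
         (\<lambda>s' T'. run S W (Store (Const 10) (Op Add (cell 10) (Const 1))) s' T' (\<lambda>s' _. P (Suc i) s'))"
        by (rule run_Skip, simp, rule step) (use lt m' d in \<open>auto simp: Min_lessThan_Suc[of "Suc i"]\<close>)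
    qed simp
    then show "(\<exists>v. eval S W (fst s) (Op Less (cell 10) (cell bnd)) = Some (Num v) \<and> v \<noteq> 0) \<and>
      run S W (Seq (If (Op Less src (Mem (cell 11))) (Store (cell 11) src) Skip)
               (Store (Const 10) (Op Add (cell 10) (Const 1)))) s
          (20 + 2 * cost src) (\<lambda>s' _. P (Suc i) s')" using g1 by auto
  next
    fix s assume "P (N - 1) s"
    then show "eval S W (fst s) (Op Less (cell 10) (cell bnd)) = Some (Num 0)"
      using S N d by (auto simp: P_def num_word_def)
  next
    show "(N - 1) * (1 + cost (Op Less (cell 10) (cell bnd)) + (20 + 2 * cost src)) + 1 +
        cost (Op Less (cell 10) (cell bnd)) \<le> T'"
    proof -
      have "(N - 1) * (26 + 2 * cost src) \<le> (N - 1) * (30 + 2 * cost src)" by (rule mult_le_mono2) simp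
      with T' have "(N - 1) * (26 + 2 * cost src) + 6 \<le> T'" by linarith
      then show ?thesis by simp
    qed
  next
    fix s' :: "'a memory \<times> 'a message list" and r :: nat assume "P (N - 1) s'"
    then show "case s' of (m', out') \<Rightarrow> out' = out \<and> m' d = Entry (MIN w\<in>{..<N}. g w) \<and>
      (\<forall>a. a \<noteq> 10 \<longrightarrow> a \<noteq> d \<longrightarrow> m' a = m a)"
      using \<open>0 < N\<close> by (auto simp: P_def)
  qed
  have "run S W (min_loop bnd src) (m, out) T
    (\<lambda>s' _. case s' of (m', out') \<Rightarrow> out' = out \<and> m' d = Entry (MIN w\<in>{..<N}. g w) \<and>
       (\<forall>a. a \<noteq> 10 \<longrightarrow> a \<noteq> d \<longrightarrow> m' a = m a))"
    unfolding min_loop_def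
    apply (rule run_Seq, rule run_Store[where a = 10 and v = "Num 0"])
    using S T apply (simp_all add: num_word_def)[4]
    apply (fold m1_def)
    apply (rule run_Seq, rule run_Store[where a = d, OF _ _ src1])
    using S d T apply (simp_all add: num_word_def m1_def)[3]
    apply (rule run_Seq, rule run_Store[where a = 10 and v = "Num 1"])
    using S T apply (simp_all add: num_word_def)[4]
    apply (fold m2_def)
    apply (rule loop)
    using T by simp
  then show ?thesis unfolding T_def .
qed

text \<open>One loop serves both phases: before the first exchange the group size is 1 and a machine
  handles every position; later it visits only those congruent to its number.\<close>

definition combine :: "nat \<Rightarrow> expr \<Rightarrow> com" where
  "combine bnd src =
    Seq (Store (Const 9) (Op Mod (cell 0) (cell 6)))
        (While (Op Less (cell 9) (cell 5))
          (Seq (Store (Const 11) (Op Add (Const 18) (Op Mult (Const 4) (Op Div (cell 9) (cell 6)))))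
          (Seq (min_loop bnd src)
               (Store (Const 9) (Op Add (cell 9) (cell 6))))))"

text \<open>Supplies the iteration count for \<open>run_While\<close>. It may be 0: if
  \<open>st\<close> exceeds \<open>f\<close>, some machines of a group have no position to
  handle.\<close>

lemma ex_progression_count:
  fixes s0 :: nat
  assumes "0 < st"
  obtains I where "\<And>i. i < I \<longleftrightarrow> s0 + i * st < f" "I \<le> f div st + 1"
proof -
  define I where "I = (LEAST i. f \<le> s0 + i * st)"
  have f: "f \<le> s0 + (f div st + 1) * st"
    using dividend_less_div_times[OF assms, of f] by simp
  then have "I \<le> f div st + 1" unfolding I_def by (rule Least_le)
  moreover have "i < I \<longleftrightarrow> s0 + i * st < f" for i
  proof
    show "i < I \<Longrightarrow> s0 + i * st < f" using not_less_Least[of i "\<lambda>i. f \<le> s0 + i * st"] by (auto simp: I_def)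
    have "f \<le> s0 + I * st" unfolding I_def by (rule LeastI) (rule f)
    then show "s0 + i * st < f \<Longrightarrow> i < I"
      by (metis add_left_mono le_less_trans linorder_not_less mult_le_mono1 order_less_irrefl)
  qed
  ultimately show thesis using that by blast
qed

lemma progression_eq_residues:
  fixes st :: nat
  assumes "\<And>i. i < I \<longleftrightarrow> x mod st + i * st < f"
  shows "(\<lambda>i. x mod st + i * st) ` {..<I} = {s. s < f \<and> s mod st = x mod st}"
proof (intro equalityI subsetI)
  fix s assume s: "s \<in> {s. s < f \<and> s mod st = x mod st}"
  then have "s = x mod st + s div st * st" using mod_div_mult_eq[of s st] by simp
  moreover from this s have "s div st \<in> {..<I}" using assms[of "s div st"] by simp
  ultimately show "s \<in> (\<lambda>i. x mod st + i * st) ` {..<I}" by (rule image_eqI)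
next
  fix s assume "s \<in> (\<lambda>i. x mod st + i * st) ` {..<I}"
  then obtain i where "s = x mod st + i * st" "i < I" by blast
  with assms[of i] show "s \<in> {s. s < f \<and> s mod st = x mod st}" by simp
qed

text \<open>\<open>f + st \<le> W\<close> is there because the position variable leaves the loop
  with a value that may reach \<open>f\<close> or more but stays below \<open>f + st\<close>. The
  frame exempts the whole array of partial minima, so a source cannot rely on it.\<close>

lemma run_combine:
  fixes m :: "'a :: linordered_ab_semigroup_add memory"
  assumes S: "20 + 4 * f \<le> S" "S \<le> W" "f + st \<le> W"
    and m: "m 0 = Num x" "x \<le> W" "m 5 = Num f" "m 6 = Num st" "0 < st"
    and N: "bnd < 9" "m bnd = Num N" "0 < N" "N \<le> W"
    and src: "\<And>m' s w. s < f \<Longrightarrow> s mod st = x mod st \<Longrightarrow> w < N \<Longrightarrow>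
        (\<And>a. a \<notin> {9, 10, 11} \<Longrightarrow> (\<And>c. a \<noteq> 18 + 4 * c) \<Longrightarrow> m' a = m a) \<Longrightarrow>
        m' 9 = Num s \<Longrightarrow> m' 10 = Num w \<Longrightarrow> eval S W m' src = Some (Entry (g s w))"
  shows "run S W (combine bnd src) (m, out) ((f div st + 1) * (30 + N * (30 + 2 * cost src)) + 15)
    (\<lambda>s' _. case s' of (m', out') \<Rightarrow> out' = out \<and>
       (\<forall>s<f. s mod st = x mod st \<longrightarrow> m' (18 + 4 * (s div st)) = Entry (MIN w\<in>{..<N}. g s w)) \<and>
       (\<forall>a. a \<notin> {9, 10, 11} \<longrightarrow> (\<forall>c. a \<noteq> 18 + 4 * c) \<longrightarrow> m' a = m a))"
proof -
  define s0 where "s0 = x mod st"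
  have s0: "s0 < st" using m by (simp add: s0_def)
  obtain I where I: "\<And>i. i < I \<longleftrightarrow> s0 + i * st < f" "I \<le> f div st + 1"
    using ex_progression_count[OF \<open>0 < st\<close>] by blast
  have div_s: "(s0 + i * st) div st = i" for i using s0 by simp
  have mod_s: "(s0 + i * st) mod st = x mod st" for i using s0 by (simp add: s0_def)
  have i_le: "i < f" if "i < I" for i
  proof -
    have "i \<le> i * st" using \<open>0 < st\<close> by simp
    with I(1)[of i] that show ?thesis by linarith
  qed
  define P where "P = (\<lambda>i (m', out'). out' = out \<and> m' 9 = Num (s0 + i * st) \<and>
    (\<forall>j<i. m' (18 + 4 * j) = Entry (MIN w\<in>{..<N}. g (s0 + j * st) w)) \<and>
    (\<forall>a. a \<notin> {9, 10, 11} \<longrightarrow> (\<forall>c. a \<noteq> 18 + 4 * c) \<longrightarrow> m' a = m a))"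
  let ?body = "Seq (Store (Const 11) (Op Add (Const 18) (Op Mult (Const 4) (Op Div (cell 9) (cell 6)))))
          (Seq (min_loop bnd src)
               (Store (Const 9) (Op Add (cell 9) (cell 6))))"
  let ?Tb = "N * (30 + 2 * cost src) + 20"
  show ?thesis
    unfolding combine_def
  proof (rule run_Seq, rule run_Store[where a = 9 and v = "Num s0"])
    show "eval S W m (Op Mod (cell 0) (cell 6)) = Some (Num s0)"
      using S m by (auto simp: num_word_def s0_def intro: le_trans[OF mod_less_eq_dividend])
    show "run S W (While (Op Less (cell 9) (cell 5)) ?body) (m(9 := Num s0), out)
      ((f div st + 1) * (30 + N * (30 + 2 * cost src)) + 15 - (1 + cost (Const 9) + cost (Op Mod (cell 0) (cell 6))))
     (\<lambda>s' _. case s' of (m', out') \<Rightarrow> out' = out \<and>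
       (\<forall>s<f. s mod st = x mod st \<longrightarrow> m' (18 + 4 * (s div st)) = Entry (MIN w\<in>{..<N}. g s w)) \<and>
       (\<forall>a. a \<notin> {9, 10, 11} \<longrightarrow> (\<forall>c. a \<noteq> 18 + 4 * c) \<longrightarrow> m' a = m a))"
    proof (rule run_While[where P = P and N = I and Tb = ?Tb])
      show "P 0 (m(9 := Num s0), out)" by (simp add: P_def)
    next
      fix i s assume i: "i < I" and "P i s"
      then obtain m' where s: "s = (m', out)" and m': "m' 9 = Num (s0 + i * st)"
        "\<And>j. j < i \<Longrightarrow> m' (18 + 4 * j) = Entry (MIN w\<in>{..<N}. g (s0 + j * st) w)"
        "\<And>a. a \<notin> {9, 10, 11} \<Longrightarrow> (\<And>c. a \<noteq> 18 + 4 * c) \<Longrightarrow> m' a = m a"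
        by (auto simp: P_def)
      have c: "m' 5 = Num f" "m' 6 = Num st" "m' bnd = Num N"
        using m'(3)[of 5] m'(3)[of 6] m'(3)[of bnd] m N by auto
      have lt: "s0 + i * st < f" and il: "i < f" using I(1) i i_le by auto
      have g1: "eval S W (fst s) (Op Less (cell 9) (cell 5)) = Some (Num 1)"
        using S m c m'(1) lt by (simp add: s num_word_def)
      have "run S W ?body s ?Tb (\<lambda>s' _. P (Suc i) s')"
        unfolding s
      proof (rule run_Seq, rule run_Store[where a = 11 and v = "Num (18 + 4 * i)"])
        show "eval S W m' (Op Add (Const 18) (Op Mult (Const 4) (Op Div (cell 9) (cell 6)))) =
            Some (Num (18 + 4 * i))"
          using S c m'(1) il div_s[of i] by (simp add: num_word_def)
        let ?m = "m'(11 := Num (18 + 4 * i))"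
        show "run S W (Seq (min_loop bnd src) (Store (Const 9) (Op Add (cell 9) (cell 6)))) (?m, out)
          (?Tb - (1 + cost (Const 11) + cost (Op Add (Const 18) (Op Mult (Const 4) (Op Div (cell 9) (cell 6))))))
          (\<lambda>s' _. P (Suc i) s')"
        proof (rule run_Seq, rule run_conseq[OF run_min_loop[where d = "18 + 4 * i" and N = N and g = "g (s0 + i * st)"]])
          fix m'' w
          assume w: "w < N" "\<And>a. a \<noteq> 10 \<Longrightarrow> a \<noteq> 18 + 4 * i \<Longrightarrow> m'' a = ?m a" "m'' 10 = Num w"
          show "eval S W m'' src = Some (Entry (g (s0 + i * st) w))"
          proof (rule src[where s = "s0 + i * st" and w = w])
            fix a :: nat assume "a \<notin> {9, 10, 11}" "\<And>c. a \<noteq> 18 + 4 * c"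
            then show "m'' a = m a" using m'(3)[of a] w(2)[of a] by simp
          next
            show "s0 + i * st < f" "(s0 + i * st) mod st = x mod st" "w < N" "m'' 10 = Num w"
              by (fact lt mod_s w)+
          next
            show "m'' 9 = Num (s0 + i * st)" using w(2)[of 9] m'(1) by simp
          qed
        next
          fix s' :: "'a memory \<times> 'a message list" and r :: nat
          assume "case s' of (m'', out') \<Rightarrow> out' = out \<and> m'' (18 + 4 * i) = Entry (MIN w\<in>{..<N}. g (s0 + i * st) w) \<and>
            (\<forall>a. a \<noteq> 10 \<longrightarrow> a \<noteq> 18 + 4 * i \<longrightarrow> m'' a = ?m a)"
            and r: "?Tb - (1 + cost (Const 11) + cost (Op Add (Const 18) (Op Mult (Const 4) (Op Div (cell 9) (cell 6))))) -
               N * (30 + 2 * cost src) \<le> r"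
          then obtain m'' where s': "s' = (m'', out)" and
            m'': "m'' (18 + 4 * i) = Entry (MIN w\<in>{..<N}. g (s0 + i * st) w)"
            "\<And>a. a \<noteq> 10 \<Longrightarrow> a \<noteq> 18 + 4 * i \<Longrightarrow> m'' a = ?m a" by auto
          have c'': "m'' 9 = Num (s0 + i * st)" "m'' 6 = Num st"
            using m''(2)[of 9] m''(2)[of 6] m'(1) c by auto
          have old: "m'' (18 + 4 * j) = Entry (MIN w\<in>{..<N}. g (s0 + j * st) w)" if "j < i" for j
            using m''(2)[of "18 + 4 * j"] m'(2)[OF that] that by simp
          have frame: "m'' a = m a" if "a \<notin> {9, 10, 11}" "\<forall>c. a \<noteq> 18 + 4 * c" for a
            using m''(2)[of a] m'(3)[of a] that by simp
          show "run S W (Store (Const 9) (Op Add (cell 9) (cell 6))) s' r (\<lambda>s' _. P (Suc i) s')"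
            unfolding s'
          proof (rule run_Store[where a = 9 and v = "Num (s0 + Suc i * st)"])
            show "eval S W m'' (Op Add (cell 9) (cell 6)) = Some (Num (s0 + Suc i * st))"
              using S c'' lt by (simp add: num_word_def)
            show "P (Suc i) (m''(9 := Num (s0 + Suc i * st)), out)"
              using old frame m''(1) by (auto simp: P_def less_Suc_eq)
          qed (use S r in \<open>auto simp: num_word_def\<close>)
        qed (use S N c il in \<open>auto simp: num_word_def\<close>)
      qed (use S in \<open>auto simp: num_word_def\<close>)
      then show "(\<exists>v. eval S W (fst s) (Op Less (cell 9) (cell 5)) = Some (Num v) \<and> v \<noteq> 0) \<and>
        run S W ?body s ?Tb (\<lambda>s' _. P (Suc i) s')" using g1 by auto
    next
      fix s assume "P I s"
      then obtain m' where s: "s = (m', out)" and m': "m' 9 = Num (s0 + I * st)"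
        "\<And>a. a \<notin> {9, 10, 11} \<Longrightarrow> (\<And>c. a \<noteq> 18 + 4 * c) \<Longrightarrow> m' a = m a"
        by (auto simp: P_def)
      have "m' 5 = Num f" using m'(2)[of 5] m by auto
      then show "eval S W (fst s) (Op Less (cell 9) (cell 5)) = Some (Num 0)"
        using S m'(1) I(1)[of I] by (simp add: s num_word_def)
    next
      have "I * (26 + N * (30 + 2 * cost src)) \<le> (f div st + 1) * (30 + N * (30 + 2 * cost src))"
        by (rule mult_le_mono[OF I(2)]) simp
      then show "I * (1 + cost (Op Less (cell 9) (cell 5)) + ?Tb) + 1 + cost (Op Less (cell 9) (cell 5))
        \<le> (f div st + 1) * (30 + N * (30 + 2 * cost src)) + 15 - (1 + cost (Const 9) + cost (Op Mod (cell 0) (cell 6)))"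
        by (simp add: add.commute)
    next
      fix s' :: "'a memory \<times> 'a message list" and r :: nat assume P: "P I s'"
      have *: "m' (18 + 4 * (s div st)) = Entry (MIN w\<in>{..<N}. g s w)"
        if "s < f" "s mod st = x mod st" "P I (m', out)" for s m'
      proof -
        have s: "s0 + s div st * st = s" using that(2) mod_div_mult_eq[of s st] by (simp add: s0_def)
        then have "s div st < I" using I(1) that(1) by simp
        with that(3) have "m' (18 + 4 * (s div st)) = Entry (MIN w\<in>{..<N}. g (s0 + s div st * st) w)"
          by (simp add: P_def)
        then show ?thesis by (simp only: s)
      qed
      show "case s' of (m', out') \<Rightarrow> out' = out \<and>
       (\<forall>s<f. s mod st = x mod st \<longrightarrow> m' (18 + 4 * (s div st)) = Entry (MIN w\<in>{..<N}. g s w)) \<and>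
       (\<forall>a. a \<notin> {9, 10, 11} \<longrightarrow> (\<forall>c. a \<noteq> 18 + 4 * c) \<longrightarrow> m' a = m a)"
        using P * by (auto simp: P_def)
    qed
  qed (use S in \<open>auto simp: num_word_def\<close>)
qed

section \<open>Exchanging partial minima between groups\<close>

text \<open>
  Passing from groups of size \<open>st\<close> to groups of size \<open>st'\<close>: the value for position \<open>s\<close> goes to the
  machine of the new group whose number is congruent to \<open>s\<close>, into the slot of the sender's old group.
  The formula covers both the all-to-all exchange of the first round and the later gathering.
\<close>

definition msg :: "nat \<Rightarrow> nat \<Rightarrow> nat \<Rightarrow> 'a memory \<Rightarrow> nat \<Rightarrow> 'a message" where
  "msg st st' x m s =
    (x div st' * st' + s mod st', 19 + 4 * (s div st' * (st' div st) + x mod st' div st),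
     m (18 + 4 * (s div st)))"

text \<open>The new size waits in cell 8 until the loop is over, because the sender's own indices
  still refer to the old size in cell 6. Cell 7, the number of old groups per new group, is already
  needed for the addresses.\<close>

definition send_com :: com where
  "send_com =
    Seq (Store (Const 8) (Op Mult (cell 6) (cell 5)))
   (Seq (If (Op Less (cell 3) (cell 8)) (Store (Const 8) (cell 3)) Skip)
   (Seq (Store (Const 7) (Op Div (cell 8) (cell 6)))
   (Seq (Store (Const 9) (Op Mod (cell 0) (cell 6)))
   (Seq (While (Op Less (cell 9) (cell 5))
          (Seq (Send (Op Add (Op Mult (Op Div (cell 0) (cell 8)) (cell 8)) (Op Mod (cell 9) (cell 8)))
                     (Op Add (Const 19) (Op Mult (Const 4)
                       (Op Add (Op Mult (Op Div (cell 9) (cell 8)) (cell 7))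
                               (Op Div (Op Mod (cell 0) (cell 8)) (cell 6)))))
                     (Mem (Op Add (Const 18) (Op Mult (Const 4) (Op Div (cell 9) (cell 6))))))
               (Store (Const 9) (Op Add (cell 9) (cell 6)))))
        (Store (Const 6) (cell 8))))))"

text \<open>The first summand is at most \<open>s\<close>, the second at most \<open>f\<close>.
  Hence the array of received values gets \<open>2 * f\<close> slots, which, with four arrays
  interleaved, accounts for the bound \<open>20 + 8 * f\<close> on memory.\<close>

lemma slot_less:
  fixes s :: nat
  assumes "0 < st" "st \<le> st'" "st' \<le> st * f" "s < f"
  shows "s div st' * (st' div st) + x mod st' div st < 2 * f"
proof -
  have "st' div st \<le> st'" by simp
  then have "s div st' * (st' div st) \<le> s div st' * st'" by (rule mult_le_mono2)
  then have 1: "s div st' * (st' div st) \<le> s" by (rule le_trans) simp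
  have "x mod st' div st \<le> st' div st"
    using assms by (intro div_le_mono) simp
  also have "\<dots> \<le> st * f div st" using assms by (intro div_le_mono) simp
  finally have "x mod st' div st \<le> f" using assms by simp
  with 1 assms show ?thesis by linarith
qed

text \<open>The order of sending is forgotten: for the exchange only the set of positions and the
  absence of repetitions matter.\<close>

lemma run_send:
  fixes m :: "'a :: linordered_ab_semigroup_add memory"
  assumes S: "20 + 8 * f \<le> S" "S \<le> W" "f + st \<le> W" "st * f \<le> W" "x + q \<le> W"
    and m: "m 0 = Num x" "m 3 = Num q" "m 5 = Num f" "m 6 = Num st"
    and st: "0 < st" "st < q" "0 < f"
    and st': "st' = min (st * f) q"
  shows "run S W send_com (m, out) ((f div st + 1) * 100 + 60)
    (\<lambda>s' _. case s' of (m', out') \<Rightarrow>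
       (\<exists>ss. out' = out @ map (msg st st' x m) ss \<and> distinct ss \<and>
          set ss = {s. s < f \<and> s mod st = x mod st}) \<and>
       m' 6 = Num st' \<and> m' 7 = Num (st' div st) \<and> (\<forall>a. a \<notin> {6, 7, 8, 9} \<longrightarrow> m' a = m a))"
proof -
  define s0 where "s0 = x mod st"
  have s0: "s0 < st" using st by (simp add: s0_def)
  obtain I where I: "\<And>i. i < I \<longleftrightarrow> s0 + i * st < f" "I \<le> f div st + 1"
    using ex_progression_count[OF \<open>0 < st\<close>] by blast
  have div_s: "(s0 + i * st) div st = i" for i using s0 by simp
  have le: "st \<le> st'" "st' \<le> st * f" "st' \<le> q" "0 < st'" using st st' by auto
  have x: "x \<le> W" "x div st' * st' \<le> x" "x mod st' \<le> x" "x mod st' < st'" "x mod st' div st \<le> x"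
    using S le by (auto intro: le_trans[OF div_le_dividend])
  have "st' div st \<le> st'" by simp
  with le S have c_le: "st' div st \<le> W" by linarith
  define m1 where "m1 = m(8 := Num (st * f))"
  define m2 where "m2 = m(8 := Num st')"
  define m3 where "m3 = m2(7 := Num (st' div st))"
  define m4 where "m4 = m3(9 := Num s0)"
  define P where "P = (\<lambda>i (m', out'). out' = out @ map (msg st st' x m) (map (\<lambda>j. s0 + j * st) [0..<i]) \<and>
     m' 9 = Num (s0 + i * st) \<and> (\<forall>a. a \<noteq> 9 \<longrightarrow> m' a = m4 a))"
  let ?dst = "Op Add (Op Mult (Op Div (cell 0) (cell 8)) (cell 8)) (Op Mod (cell 9) (cell 8))"
  let ?adr = "Op Add (Const 19) (Op Mult (Const 4)
                       (Op Add (Op Mult (Op Div (cell 9) (cell 8)) (cell 7))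
                               (Op Div (Op Mod (cell 0) (cell 8)) (cell 6))))"
  let ?val = "Mem (Op Add (Const 18) (Op Mult (Const 4) (Op Div (cell 9) (cell 6))))"
  let ?body = "Seq (Send ?dst ?adr ?val) (Store (Const 9) (Op Add (cell 9) (cell 6)))"
  let ?Q = "\<lambda>s' _. case s' of (m', out') \<Rightarrow>
       (\<exists>ss. out' = out @ map (msg st st' x m) ss \<and> distinct ss \<and>
          set ss = {s. s < f \<and> s mod st = x mod st}) \<and>
       m' 6 = Num st' \<and> m' 7 = Num (st' div st) \<and> (\<forall>a. a \<notin> {6, 7, 8, 9} \<longrightarrow> m' a = m a)"
  have final: "run S W (Store (Const 6) (cell 8)) s' r ?Q" if P: "P I s'" and r: "5 \<le> r" for s' r
  proof -
    from P obtain m' where s': "s' = (m', out @ map (msg st st' x m) (map (\<lambda>j. s0 + j * st) [0..<I]))"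
      and m': "\<And>a. a \<noteq> 9 \<Longrightarrow> m' a = m4 a" by (auto simp: P_def)
    have "distinct (map (\<lambda>j. s0 + j * st) [0..<I])"
      using st by (auto simp: distinct_map inj_on_def)
    moreover have "set (map (\<lambda>j. s0 + j * st) [0..<I]) = {s. s < f \<and> s mod st = x mod st}"
      using progression_eq_residues[of I x st f] I(1) by (simp add: s0_def atLeast0LessThan)
    ultimately have ss: "\<exists>ss. out @ map (msg st st' x m) (map (\<lambda>j. s0 + j * st) [0..<I]) =
       out @ map (msg st st' x m) ss \<and> distinct ss \<and> set ss = {s. s < f \<and> s mod st = x mod st}"
      by blast
    show ?thesis unfolding s'
    proof (rule run_Store[where a = 6 and v = "Num st'"])
      show "eval S W m' (cell 8) = Some (Num st')"
        using S m'[of 8] by (simp add: num_word_def m4_def m3_def m2_def)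
      show "case (m'(6 := Num st'), out @ map (msg st st' x m) (map (\<lambda>j. s0 + j * st) [0..<I])) of (m', out') \<Rightarrow>
       (\<exists>ss. out' = out @ map (msg st st' x m) ss \<and> distinct ss \<and>
          set ss = {s. s < f \<and> s mod st = x mod st}) \<and>
       m' 6 = Num st' \<and> m' 7 = Num (st' div st) \<and> (\<forall>a. a \<notin> {6, 7, 8, 9} \<longrightarrow> m' a = m a)"
        using ss m' by (simp add: m4_def m3_def m2_def)
    qed (use S r in \<open>auto simp: num_word_def\<close>)
  qed
  have loop: "run S W (While (Op Less (cell 9) (cell 5)) ?body) (m4, out) T
      (\<lambda>s' T'. run S W (Store (Const 6) (cell 8)) s' T' ?Q)"
    if T: "(f div st + 1) * 100 + 11 \<le> T" for T
  proof (rule run_While[where P = P and N = I and Tb = "90"])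
    show "P 0 (m4, out)" by (simp add: P_def m4_def)
  next
    fix i s assume i: "i < I" and "P i s"
    let ?s = "s0 + i * st"
    let ?out = "out @ map (msg st st' x m) (map (\<lambda>j. s0 + j * st) [0..<i])"
    from \<open>P i s\<close> obtain m' where s: "s = (m', ?out)"
      and m': "m' 9 = Num ?s" "\<And>a. a \<noteq> 9 \<Longrightarrow> m' a = m4 a"
      by (auto simp: P_def)
    have c: "m' 0 = Num x" "m' 5 = Num f" "m' 6 = Num st" "m' 7 = Num (st' div st)" "m' 8 = Num st'"
      using m'(2)[of 0] m'(2)[of 5] m'(2)[of 6] m'(2)[of 7] m'(2)[of 8] m
      by (auto simp: m4_def m3_def m2_def)
    have C: "m' (18 + 4 * j) = m (18 + 4 * j)" for j
      using m'(2)[of "18 + 4 * j"] by (simp add: m4_def m3_def m2_def)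
    have lt: "?s < f" using I(1) i by auto
    have "i \<le> i * st" using st by simp
    with lt have il: "i < f" by linarith
    have g1: "eval S W (fst s) (Op Less (cell 9) (cell 5)) = Some (Num 1)"
      using S c m'(1) lt by (simp add: s num_word_def)
    have mod_le: "?s mod st' < st'" "?s mod st' \<le> ?s" "?s div st' \<le> ?s" using le by auto
    have slot: "?s div st' * (st' div st) + x mod st' div st < 2 * f"
      using slot_less[OF _ _ _ lt] st le by blast
    have e1: "eval S W m' ?dst = Some (Num (x div st' * st' + ?s mod st'))"
    proof -
      have "x div st' * st' + ?s mod st' \<le> W" "x div st' * st' \<le> W" "x div st' \<le> W" "?s mod st' \<le> W"
        using x mod_le S le(3) by (linarith, linarith, metis div_le_dividend le_trans, linarith)
      then show ?thesis using S le(4) c m'(1) by (simp add: num_word_def)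
    qed
    have e2: "eval S W m' ?adr = Some (Num (19 + 4 * (?s div st' * (st' div st) + x mod st' div st)))"
    proof -
      have X: "4 * X \<le> W" "19 + 4 * X \<le> W" if "X < 2 * f" for X
        using S that by linarith+
      have bnd: "?s div st' \<le> W" "x mod st' \<le> W" "x mod st' div st \<le> W"
        "?s div st' * (st' div st) + x mod st' div st \<le> W"
        "?s div st' * (st' div st) \<le> W"
        "19 \<le> W" "4 \<le> W"
        using slot S mod_le(3) lt x by linarith+
      have v: "eval S W m' (cell 0) = Some (Num x)" "eval S W m' (cell 6) = Some (Num st)"
        "eval S W m' (cell 7) = Some (Num (st' div st))" "eval S W m' (cell 8) = Some (Num st')"
        "eval S W m' (cell 9) = Some (Num ?s)"
        using S c m'(1) by (simp_all add: num_word_def)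
      show ?thesis
        unfolding eval.simps(3) v
        by (simp only: eval.simps(1) option.case prod.case num_word_def apply_op.simps bnd X[OF slot] if_True)
    qed
    have e3: "eval S W m' ?val = Some (m (18 + 4 * i))"
      using S c m'(1) il div_s[of i] C by (simp add: num_word_def)
    have "run S W ?body s 90 (\<lambda>s' _. P (Suc i) s')"
      unfolding s
    proof (rule run_Seq, rule run_Send[OF e1 e2 e3])
      show "run S W (Store (Const 9) (Op Add (cell 9) (cell 6)))
       (m', ?out @ [(x div st' * st' + ?s mod st', 19 + 4 * (?s div st' * (st' div st) + x mod st' div st), m (18 + 4 * i))])
       (90 - (1 + cost ?dst + cost ?adr + cost ?val)) (\<lambda>s' _. P (Suc i) s')"
      proof (rule run_Store[where a = 9 and v = "Num (s0 + Suc i * st)"])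
        show "eval S W m' (Op Add (cell 9) (cell 6)) = Some (Num (s0 + Suc i * st))"
          using S c m'(1) lt by (simp add: num_word_def)
        show "P (Suc i) (m'(9 := Num (s0 + Suc i * st)),
          ?out @ [(x div st' * st' + ?s mod st', 19 + 4 * (?s div st' * (st' div st) + x mod st' div st), m (18 + 4 * i))])"
          using m'(2) by (simp add: P_def msg_def div_s del: upt_Suc) (simp add: msg_def div_s)
      qed (use S in \<open>auto simp: num_word_def\<close>)
    qed simp
    then show "(\<exists>v. eval S W (fst s) (Op Less (cell 9) (cell 5)) = Some (Num v) \<and> v \<noteq> 0) \<and>
      run S W ?body s 90 (\<lambda>s' _. P (Suc i) s')" using g1 by auto
  next
    fix s assume "P I s"
    then obtain m' out' where s: "s = (m', out')" and m': "m' 9 = Num (s0 + I * st)"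
      "\<And>a. a \<noteq> 9 \<Longrightarrow> m' a = m4 a"
      by (auto simp: P_def)
    have "m' 5 = Num f" using m'(2)[of 5] m by (auto simp: m4_def m3_def m2_def)
    then show "eval S W (fst s) (Op Less (cell 9) (cell 5)) = Some (Num 0)"
      using S m'(1) I(1)[of I] by (simp add: s num_word_def)
  next
    have "I * 96 \<le> (f div st + 1) * 100" by (rule mult_le_mono[OF I(2)]) simp
    then show "I * (1 + cost (Op Less (cell 9) (cell 5)) + 90) + 1 + cost (Op Less (cell 9) (cell 5)) \<le> T"
      using T by simp
  next
    fix s' :: "'a memory \<times> 'a message list" and r :: nat
    assume P: "P I s'" and "T - (I * (1 + cost (Op Less (cell 9) (cell 5)) + 90) + 1 + cost (Op Less (cell 9) (cell 5))) \<le> r"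
    moreover have "I * 96 \<le> (f div st + 1) * 100" by (rule mult_le_mono[OF I(2)]) simp
    ultimately have "5 \<le> r" using T by simp
    with P show "run S W (Store (Const 6) (cell 8)) s' r ?Q" by (rule final)
  qed
  have rest: "run S W (Seq (Store (Const 7) (Op Div (cell 8) (cell 6)))
     (Seq (Store (Const 9) (Op Mod (cell 0) (cell 6)))
     (Seq (While (Op Less (cell 9) (cell 5)) ?body) (Store (Const 6) (cell 8))))) (m2, out) T ?Q"
    if T: "(f div st + 1) * 100 + 30 \<le> T" for T
  proof (rule run_Seq, rule run_Store[where a = 7 and v = "Num (st' div st)"])
    show "eval S W m2 (Op Div (cell 8) (cell 6)) = Some (Num (st' div st))"
      using S m c_le by (simp add: m2_def num_word_def)
    show "run S W (Seq (Store (Const 9) (Op Mod (cell 0) (cell 6)))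
       (Seq (While (Op Less (cell 9) (cell 5)) ?body) (Store (Const 6) (cell 8))))
       (m2(7 := Num (st' div st)), out) (T - (1 + cost (Const 7) + cost (Op Div (cell 8) (cell 6)))) ?Q"
    proof (fold m3_def, rule run_Seq, rule run_Store[where a = 9 and v = "Num s0"])
      show "eval S W m3 (Op Mod (cell 0) (cell 6)) = Some (Num s0)"
        using S m s0 by (simp add: m3_def m2_def num_word_def s0_def)
      show "run S W (Seq (While (Op Less (cell 9) (cell 5)) ?body) (Store (Const 6) (cell 8)))
       (m3(9 := Num s0), out) (T - (1 + cost (Const 7) + cost (Op Div (cell 8) (cell 6))) -
          (1 + cost (Const 9) + cost (Op Mod (cell 0) (cell 6)))) ?Q"
        by (fold m4_def, rule run_Seq, rule loop) (use T in simp)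
    qed (use S T in \<open>auto simp: num_word_def\<close>)
  qed (use S T in \<open>auto simp: num_word_def\<close>)
  show ?thesis
    unfolding send_com_def
  proof (rule run_Seq, rule run_Store[where a = 8 and v = "Num (st * f)"])
    show "eval S W m (Op Mult (cell 6) (cell 5)) = Some (Num (st * f))"
      using S m by (simp add: num_word_def)
    show "run S W (Seq (If (Op Less (cell 3) (cell 8)) (Store (Const 8) (cell 3)) Skip)
     (Seq (Store (Const 7) (Op Div (cell 8) (cell 6)))
     (Seq (Store (Const 9) (Op Mod (cell 0) (cell 6)))
     (Seq (While (Op Less (cell 9) (cell 5)) ?body) (Store (Const 6) (cell 8))))))
     (m(8 := Num (st * f)), out) ((f div st + 1) * 100 + 60 - (1 + cost (Const 8) + cost (Op Mult (cell 6) (cell 5)))) ?Q"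
    proof (fold m1_def, rule run_Seq, rule run_If)
      show "eval S W (fst (m1, out)) (Op Less (cell 3) (cell 8)) = Some (Num (if q < st * f then 1 else 0))"
        using S m by (simp add: m1_def num_word_def)
    next
      assume "(if q < st * f then 1 else 0 :: nat) \<noteq> 0"
      then have "q = st'" by (simp add: st' split: if_splits)
      then have "m1(8 := Num q) = m2" by (simp add: m1_def m2_def)
      then show "run S W (Store (Const 8) (cell 3)) (m1, out)
        ((f div st + 1) * 100 + 60 - (1 + cost (Const 8) + cost (Op Mult (cell 6) (cell 5))) - (1 + cost (Op Less (cell 3) (cell 8))))
        (\<lambda>s' T'. run S W (Seq (Store (Const 7) (Op Div (cell 8) (cell 6)))
         (Seq (Store (Const 9) (Op Mod (cell 0) (cell 6)))
         (Seq (While (Op Less (cell 9) (cell 5)) ?body) (Store (Const 6) (cell 8))))) s' T' ?Q)"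
        apply (intro run_Store[where a = 8 and v = "Num q"])
        subgoal using S by (simp add: num_word_def)
        subgoal using S by simp
        subgoal using S m by (simp add: num_word_def m1_def)
        subgoal by simp
        subgoal by (simp only:, rule rest) simp
        done
    next
      assume "(if q < st * f then 1 else 0 :: nat) = 0"
      then have "st' = st * f" by (simp add: st' split: if_splits)
      then have "m1 = m2" by (simp add: m1_def m2_def)
      then show "run S W Skip (m1, out)
        ((f div st + 1) * 100 + 60 - (1 + cost (Const 8) + cost (Op Mult (cell 6) (cell 5))) - (1 + cost (Op Less (cell 3) (cell 8))))
        (\<lambda>s' T'. run S W (Seq (Store (Const 7) (Op Div (cell 8) (cell 6)))
         (Seq (Store (Const 9) (Op Mod (cell 0) (cell 6)))
         (Seq (While (Op Less (cell 9) (cell 5)) ?body) (Store (Const 6) (cell 8))))) s' T' ?Q)"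
        by (intro run_Skip, simp, simp only:, intro rest) simp
    qed simp
  qed (use S in \<open>auto simp: num_word_def\<close>)
qed

section \<open>One round on a single machine\<close>

text \<open>Used twice: to merge the minima of subgroups, and to join a block number and an index
  inside the block into one summation index.\<close>

lemma Min_lessThan_mult:
  fixes h :: "nat \<Rightarrow> 'a :: linorder"
  assumes "0 < c" "0 < d"
  shows "(MIN w\<in>{..<c}. MIN t\<in>{..<d}. h (w * d + t)) = (MIN u\<in>{..<c * d}. h u)"
proof (rule antisym)
  have ne: "{..<c} \<noteq> {}" "{..<d} \<noteq> {}" "{..<c * d} \<noteq> {}" using assms by (auto simp: lessThan_empty_iff)
  show "(MIN w\<in>{..<c}. MIN t\<in>{..<d}. h (w * d + t)) \<le> (MIN u\<in>{..<c * d}. h u)"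
  proof (rule Min.boundedI)
    fix y assume "y \<in> h ` {..<c * d}"
    then obtain u where u: "y = h u" "u < c * d" by auto
    have "u div d < c" using u assms by (simp add: less_mult_imp_div_less)
    then have "(MIN w\<in>{..<c}. MIN t\<in>{..<d}. h (w * d + t)) \<le> (MIN t\<in>{..<d}. h (u div d * d + t))"
      by (intro Min_le) auto
    also have "\<dots> \<le> h (u div d * d + u mod d)" using assms by (intro Min_le) (auto intro!: image_eqI[of _ _ "u mod d"])
    finally show "(MIN w\<in>{..<c}. MIN t\<in>{..<d}. h (w * d + t)) \<le> y" using u by simp
  qed (use ne in auto)
  show "(MIN u\<in>{..<c * d}. h u) \<le> (MIN w\<in>{..<c}. MIN t\<in>{..<d}. h (w * d + t))"
  proof (rule Min.boundedI)
    fix y assume "y \<in> (\<lambda>w. MIN t\<in>{..<d}. h (w * d + t)) ` {..<c}"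
    then obtain w where w: "w < c" "y = (MIN t\<in>{..<d}. h (w * d + t))" by auto
    show "(MIN u\<in>{..<c * d}. h u) \<le> y" unfolding w(2)
    proof (rule Min.boundedI)
      fix z assume "z \<in> (\<lambda>t. h (w * d + t)) ` {..<d}"
      then obtain t where t: "t < d" "z = h (w * d + t)" by auto
      have "w * d + t < (w + 1) * d" using t by simp
      also have "\<dots> \<le> c * d" using w by (intro mult_le_mono1) simp
      finally show "(MIN u\<in>{..<c * d}. h u) \<le> z" unfolding t(2) by (intro Min_le) auto
    qed (use ne in auto)
  qed (use ne in auto)
qed

text \<open>
  Cells 3 to 11 hold \<open>q\<close>, \<open>b\<close>, \<open>f = b\<^sup>2\<close>, the current group size, the number of values received per
  position (0 before the first reduction), the next group size, the position loop, the inner loop,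
  and the target address of the inner loop. From cell 16 on four arrays are interleaved modulo 4: the blocks
  of \<open>A\<close> and \<open>B\<close>, the current partial minima, and the received values.
\<close>

definition product_src :: expr where
  "product_src = Op Add
    (Mem (Op Add (Const 16) (Op Mult (Const 4) (Op Add (Op Mult (Op Div (cell 9) (cell 4)) (cell 4)) (cell 10)))))
    (Mem (Op Add (Const 17) (Op Mult (Const 4) (Op Add (Op Mult (cell 10) (cell 4)) (Op Mod (cell 9) (cell 4))))))"

text \<open>The slot formula of \<open>msg\<close> as the receiver sees it: after the exchange cell
  6 holds the new group size and cell 7 the number of old groups in it, and cell 10 runs over these
  old groups.\<close>

definition reduce_src :: expr where
  "reduce_src = Mem (Op Add (Const 19) (Op Mult (Const 4) (Op Add (Op Mult (Op Div (cell 9) (cell 6)) (cell 7)) (cell 10))))"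

text \<open>Surplus rounds are harmless: once the group size is \<open>q\<close> nothing is sent,
  and the reduction (or the product, if \<open>q\<close> is 1) is merely repeated on unchanged
  data.\<close>

definition round_com :: com where
  "round_com = Seq (If (cell 7) (combine 7 reduce_src) (combine 4 product_src))
              (If (Op Less (cell 6) (cell 3)) send_com Skip)"

text \<open>The bounds on \<open>W\<close> cover the largest numbers that arise: the next group size
  before it is capped, the position variable at loop exit, and machine numbers in
  destinations.\<close>

locale grid =
  fixes q b f S W :: nat and a c :: "nat \<Rightarrow> nat \<Rightarrow> 'a :: linordered_ab_semigroup_add"
  assumes f_def: "f = b * b" and b_pos: "0 < b" and q_pos: "0 < q"
    and S: "20 + 8 * f \<le> S" "S \<le> W" and W: "q * f \<le> W" "q + f \<le> W" "q * q * q + q \<le> W"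
begin

text \<open>The base-\<open>q\<close> digits of \<open>x\<close> are, from the highest, row block,
  column block and summation block; \<open>u\<close> numbers the entries of a block row by
  row.\<close>

definition A_entry :: "nat \<Rightarrow> nat \<Rightarrow> 'a" where
  "A_entry x u = a (x div (q * q) * b + u div b) (x mod q * b + u mod b)"

definition B_entry :: "nat \<Rightarrow> nat \<Rightarrow> 'a" where
  "B_entry x u = c (x mod q * b + u div b) (x div q mod q * b + u mod b)"

definition block_prod :: "nat \<Rightarrow> nat \<Rightarrow> 'a" where
  "block_prod x s = (MIN w\<in>{..<b}. A_entry x (s div b * b + w) + B_entry x (w * b + s mod b))"

text \<open>A group is an aligned interval of machine numbers. The summation block is the lowest
  digit, so when \<open>st\<close> divides \<open>q\<close> all members of a group work on the same
  block of the result.\<close>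

definition group_min :: "nat \<Rightarrow> nat \<Rightarrow> nat \<Rightarrow> 'a" where
  "group_min st x s = (MIN t\<in>{..<st}. block_prod (x div st * st + t) s)"

definition consts_ok :: "nat \<Rightarrow> 'a memory \<Rightarrow> bool" where
  "consts_ok x m \<longleftrightarrow> m 0 = Num x \<and> m 3 = Num q \<and> m 4 = Num b \<and> m 5 = Num f"

definition blocks_ok :: "nat \<Rightarrow> 'a memory \<Rightarrow> bool" where
  "blocks_ok x m \<longleftrightarrow> (\<forall>u<f. m (16 + 4 * u) = Entry (A_entry x u) \<and> m (17 + 4 * u) = Entry (B_entry x u))"

text \<open>
  Machine \<open>x\<close> is responsible for the positions \<open>s\<close> congruent to \<open>x\<close> modulo the group size \<open>st\<close>; it stores
  position \<open>s\<close> at index \<open>s div st\<close>.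
\<close>

definition received :: "nat \<Rightarrow> nat \<Rightarrow> nat \<Rightarrow> 'a memory \<Rightarrow> bool" where
  "received st cnt x m \<longleftrightarrow>
     (if cnt = 0 then st = 1
      else cnt \<le> f \<and> (\<exists>d>0. st = cnt * d \<and> (\<forall>s<f. s mod st = x mod st \<longrightarrow> (\<forall>w<cnt.
        m (19 + 4 * (s div st * cnt + w)) = Entry (group_min d (x div st * st + w * d + s mod d) s)))))"

definition reduced :: "nat \<Rightarrow> nat \<Rightarrow> 'a memory \<Rightarrow> bool" where
  "reduced st x m \<longleftrightarrow> (\<forall>s<f. s mod st = x mod st \<longrightarrow> m (18 + 4 * (s div st)) = Entry (group_min st x s))"

lemma f_pos: "0 < f" using b_pos f_def by simp

lemma group_min_1: "group_min 1 x s = block_prod x s"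
  by (simp add: group_min_def lessThan_Suc)

text \<open>The \<open>cnt\<close> subgroups of size \<open>d\<close> tile the group. Adding
  \<open>s mod d\<close> only selects the member of a subgroup that is in charge of
  \<open>s\<close>; the division by \<open>d\<close> removes it again.\<close>

lemma group_min_mult:
  assumes "0 < cnt" "0 < d"
  shows "(MIN w\<in>{..<cnt}. group_min d (x div (cnt * d) * (cnt * d) + w * d + s mod d) s) = group_min (cnt * d) x s"
proof -
  have "(x div (cnt * d) * (cnt * d) + w * d + s mod d) div d * d = x div (cnt * d) * (cnt * d) + w * d" for w
  proof -
    have "x div (cnt * d) * (cnt * d) + w * d + s mod d = s mod d + (x div (cnt * d) * cnt + w) * d"
      by (simp add: algebra_simps)
    moreover have "(s mod d + K * d) div d = K" for K using assms by simp
    ultimately have "(x div (cnt * d) * (cnt * d) + w * d + s mod d) div d = x div (cnt * d) * cnt + w"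
      by metis
    then show ?thesis by (simp add: algebra_simps)
  qed
  then have "group_min d (x div (cnt * d) * (cnt * d) + w * d + s mod d) s =
      (MIN t\<in>{..<d}. block_prod (x div (cnt * d) * (cnt * d) + (w * d + t)) s)" for w
    by (simp add: group_min_def add.assoc)
  then show ?thesis
    using Min_lessThan_mult[OF assms, of "\<lambda>u. block_prod (x div (cnt * d) * (cnt * d) + u) s"]
    by (simp add: group_min_def)
qed

lemma run_product:
  assumes m: "consts_ok x m" "blocks_ok x m" "m 6 = Num st" "st = 1" and x: "x < q * q * q"
  shows "run S W (combine 4 product_src) (m, out) (300 * (b * f))
    (\<lambda>s' _. case s' of (m', out') \<Rightarrow> out' = out \<and> reduced st x m' \<and>
       (\<forall>a. a \<notin> {9, 10, 11} \<longrightarrow> (\<forall>c. a \<noteq> 18 + 4 * c) \<longrightarrow> m' a = m a))"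
proof -
  have c: "m 0 = Num x" "m 4 = Num b" "m 5 = Num f" using m by (auto simp: consts_ok_def)
  have src: "eval S W m' product_src = Some (Entry (A_entry x (s div b * b + w) + B_entry x (w * b + s mod b)))"
    if s: "s < f" "w < b" and fr: "\<And>a. a \<notin> {9, 10, 11} \<Longrightarrow> (\<And>c. a \<noteq> 18 + 4 * c) \<Longrightarrow> m' a = m a"
      and m': "m' 9 = Num s" "m' 10 = Num w" for m' s w
  proof -
    define u v where "u = s div b * b + w" and "v = w * b + s mod b"
    have le: "u' * b + w' < f" if "u' < b" "w' < b" for u' w'
    proof -
      have "u' * b + w' < (u' + 1) * b" using that by simp
      also have "\<dots> \<le> f" unfolding f_def using that by (intro mult_le_mono1) simp
      finally show ?thesis .
    qed
    have u: "u < f" unfolding u_def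
      by (rule le) (use s in \<open>auto simp: f_def less_mult_imp_div_less\<close>)
    have v: "v < f" unfolding v_def
      by (rule le) (use s b_pos in auto)
    have A: "m' (16 + 4 * u) = Entry (A_entry x u)"
    proof -
      have "m' (16 + 4 * u) = m (16 + 4 * u)" by (rule fr) (auto, presburger)
      then show ?thesis using m u by (simp add: blocks_ok_def)
    qed
    have B: "m' (17 + 4 * v) = Entry (B_entry x v)"
    proof -
      have "m' (17 + 4 * v) = m (17 + 4 * v)" by (rule fr) (auto, presburger)
      then show ?thesis using m v by (simp add: blocks_ok_def)
    qed
    have b: "m' 4 = Num b" using fr[of 4] c by simp
    have vals: "eval S W m' (cell 9) = Some (Num s)" "eval S W m' (cell 10) = Some (Num w)"
      "eval S W m' (cell 4) = Some (Num b)"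
      using S m' b by (simp_all add: num_word_def)
    have bnd: "s div b \<le> W" "s mod b \<le> W" "s div b * b \<le> W" "w * b \<le> W"
      using s v S by (auto simp: v_def intro: le_trans[OF div_le_dividend] le_trans[OF mod_less_eq_dividend] le_trans[OF div_times_less_eq_dividend])
    have bnd2: "u \<le> W" "v \<le> W" "4 * u \<le> W" "4 * v \<le> W" "16 + 4 * u \<le> W" "17 + 4 * v \<le> W"
       "16 + 4 * u < S" "17 + 4 * v < S" "4 \<le> W" "16 \<le> W" "17 \<le> W"
      using S u v by linarith+
    have 1: "eval S W m' (Op Add (Op Mult (Op Div (cell 9) (cell 4)) (cell 4)) (cell 10)) = Some (Num u)"
      unfolding eval.simps(3) vals using bnd bnd2(1) by (simp add: num_word_def u_def)
    have 2: "eval S W m' (Op Add (Op Mult (cell 10) (cell 4)) (Op Mod (cell 9) (cell 4))) = Some (Num v)"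
      unfolding eval.simps(3) vals using bnd bnd2(2) by (simp add: num_word_def v_def)
    show ?thesis
      unfolding product_src_def eval.simps(3)[where ?e1.0 = "Mem _"] eval.simps(2)[where e = "Op _ _ _"]
        eval.simps(3)[where ?e1.0 = "Const _"] 1 2
      using bnd2 A B by (simp add: num_word_def u_def[symmetric] v_def[symmetric])
  qed
  have "b \<le> f" "1 \<le> f" using b_pos by (auto simp: f_def)
  have cost: "cost product_src = 33" by (simp add: product_src_def)
  have "(f div 1 + 1) * (30 + b * (30 + 2 * cost product_src)) + 15 \<le> 300 * (b * f)"
  proof -
    have "f + 1 \<le> 2 * f" "30 + b * 96 \<le> 126 * b" "15 \<le> 15 * (b * f)" using b_pos f_pos by auto
    then have "(f + 1) * (30 + b * 96) + 15 \<le> (2 * f) * (126 * b) + 15 * (b * f)"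
      by (intro add_mono mult_le_mono)
    then show ?thesis by (simp add: cost)
  qed
  then show ?thesis
  proof (rule run_conseq[rotated])
    show "run S W (combine 4 product_src) (m, out) ((f div 1 + 1) * (30 + b * (30 + 2 * cost product_src)) + 15)
      (\<lambda>s' _. case s' of (m', out') \<Rightarrow> out' = out \<and>
       (\<forall>s<f. s mod 1 = x mod 1 \<longrightarrow> m' (18 + 4 * (s div 1)) =
          Entry (MIN w\<in>{..<b}. A_entry x (s div b * b + w) + B_entry x (w * b + s mod b))) \<and>
       (\<forall>a. a \<notin> {9, 10, 11} \<longrightarrow> (\<forall>c. a \<noteq> 18 + 4 * c) \<longrightarrow> m' a = m a))"
      by (rule run_combine) (use S W b_pos \<open>b \<le> f\<close> q_pos c m x src in auto)
  qed (auto simp: reduced_def m(4) group_min_1[unfolded One_nat_def] block_prod_def)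
qed

text \<open>Sharing the positions keeps this cheap: \<open>cnt\<close> is at most \<open>st\<close>,
  so \<open>f div st\<close> positions with \<open>cnt\<close> values each give at most
  \<open>f\<close> values, and one extra position adds at most \<open>f\<close> more. The budget is
  still that of the product, so that both branches of a round are treated alike.\<close>

lemma run_reduce:
  assumes m: "consts_ok x m" "m 6 = Num st" "m 7 = Num cnt" "received st cnt x m"
    and st: "0 < st" "st \<le> q" "0 < cnt" and x: "x < q * q * q"
  shows "run S W (combine 7 reduce_src) (m, out) (300 * (b * f))
    (\<lambda>s' _. case s' of (m', out') \<Rightarrow> out' = out \<and> reduced st x m' \<and>
       (\<forall>a. a \<notin> {9, 10, 11} \<longrightarrow> (\<forall>c. a \<noteq> 18 + 4 * c) \<longrightarrow> m' a = m a))"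
proof -
  have c: "m 0 = Num x" "m 5 = Num f" using m by (auto simp: consts_ok_def)
  \<comment> \<open>\<open>d\<close> is the group size before the preceding exchange;
    \<open>w\<close> numbers the old groups inside the present one.\<close>
  obtain d where cnt: "cnt \<le> f" and d: "0 < d" "st = cnt * d" and recv: "\<And>s w. s < f \<Longrightarrow> s mod st = x mod st \<Longrightarrow>
      w < cnt \<Longrightarrow> m (19 + 4 * (s div st * cnt + w)) = Entry (group_min d (x div st * st + w * d + s mod d) s)"
    using m(4) st by (auto simp: received_def)
  have le: "cnt \<le> st" using d by simp
  have src: "eval S W m' reduce_src = Some (Entry (group_min d (x div st * st + w * d + s mod d) s))"
    if s: "s < f" "s mod st = x mod st" "w < cnt"
      and fr: "\<And>a. a \<notin> {9, 10, 11} \<Longrightarrow> (\<And>c. a \<noteq> 18 + 4 * c) \<Longrightarrow> m' a = m a"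
      and m': "m' 9 = Num s" "m' 10 = Num w" for m' s w
  proof -
    define u where "u = s div st * cnt + w"
    have "s div st * cnt \<le> s div st * st" using le by (rule mult_le_mono2)
    then have 0: "s div st * cnt \<le> s" by (rule le_trans) simp
    then have u: "u < 2 * f" unfolding u_def using s cnt by linarith
    have R: "m' (19 + 4 * u) = Entry (group_min d (x div st * st + w * d + s mod d) s)"
    proof -
      have "m' (19 + 4 * u) = m (19 + 4 * u)" by (rule fr) (auto, presburger)
      then show ?thesis using recv[OF s] by (simp add: u_def)
    qed
    have "m' 6 = Num st" "m' 7 = Num cnt" using fr[of 6] fr[of 7] m by auto
    then have vals: "eval S W m' (cell 9) = Some (Num s)" "eval S W m' (cell 10) = Some (Num w)"
      "eval S W m' (cell 6) = Some (Num st)" "eval S W m' (cell 7) = Some (Num cnt)"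
      using S m' by (simp_all add: num_word_def)
    have bnd: "s div st \<le> W" "s div st * cnt \<le> W"
      using s S 0 by (auto intro: le_trans[OF div_le_dividend])
    have bnd2: "u \<le> W" "4 * u \<le> W" "19 + 4 * u \<le> W" "19 + 4 * u < S" "4 \<le> W" "19 \<le> W"
      using S u by linarith+
    have 1: "eval S W m' (Op Add (Op Mult (Op Div (cell 9) (cell 6)) (cell 7)) (cell 10)) = Some (Num u)"
      unfolding eval.simps(3) vals using bnd bnd2(1) st by (simp add: num_word_def u_def)
    show ?thesis
      unfolding reduce_src_def eval.simps(2)[where e = "Op _ _ _"] eval.simps(3)[where ?e1.0 = "Const _"] 1
      using bnd2 R by (simp add: num_word_def)
  qed
  have cost: "cost reduce_src = 16" by (simp add: reduce_src_def)
  have "(f div st + 1) * (30 + cnt * (30 + 2 * cost reduce_src)) + 15 \<le> 300 * (b * f)"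
  proof -
    have "f div st \<le> f" "f \<le> b * f" "0 < f" "f div st * cnt \<le> f"
      using b_pos f_pos le_trans[OF mult_le_mono2[OF le] div_times_less_eq_dividend] by auto
    moreover have "(f div st + 1) * (30 + cnt * 62) + 15 = 30 * (f div st) + 62 * (f div st * cnt) + 62 * cnt + 45"
      by (simp add: algebra_simps)
    ultimately have "(f div st + 1) * (30 + cnt * 62) + 15 \<le> 300 * (b * f)"
      using cnt by linarith
    then show ?thesis by (simp add: cost)
  qed
  then show ?thesis
  proof (rule run_conseq[rotated])
    show "run S W (combine 7 reduce_src) (m, out) ((f div st + 1) * (30 + cnt * (30 + 2 * cost reduce_src)) + 15)
      (\<lambda>s' _. case s' of (m', out') \<Rightarrow> out' = out \<and>
       (\<forall>s<f. s mod st = x mod st \<longrightarrow> m' (18 + 4 * (s div st)) =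
          Entry (MIN w\<in>{..<cnt}. group_min d (x div st * st + w * d + s mod d) s)) \<and>
       (\<forall>a. a \<notin> {9, 10, 11} \<longrightarrow> (\<forall>c. a \<noteq> 18 + 4 * c) \<longrightarrow> m' a = m a))"
      by (rule run_combine) (use S W cnt c m x src st in auto)
  qed (auto simp: reduced_def d(2) group_min_mult[OF st(3) d(1)])
qed

definition next_size :: "nat \<Rightarrow> nat" where
  "next_size st = min (st * f) q"

lemma run_body:
  assumes m: "consts_ok x m" "blocks_ok x m" "m 6 = Num st" "m 7 = Num cnt" "received st cnt x m"
    and st: "0 < st" "st \<le> q" and x: "x < q * q * q"
  shows "run S W round_com (m, []) (1000 * (b * f))
    (\<lambda>s' _. case s' of (m', out) \<Rightarrow> reduced st x m' \<and>
       m' 6 = Num (next_size st) \<and> m' 7 = Num (if st < q then next_size st div st else cnt) \<and>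
       (\<forall>a. a \<notin> {6, 7, 8, 9, 10, 11} \<longrightarrow> (\<forall>c. a \<noteq> 18 + 4 * c) \<longrightarrow> m' a = m a) \<and>
       (\<exists>ss. out = map (msg st (next_size st) x m') ss \<and> distinct ss \<and>
          set ss = {s. st < q \<and> s < f \<and> s mod st = x mod st}))"
    (is "run S W round_com _ _ ?Q")
proof -
  have bf: "f \<le> b * f" "0 < f" using b_pos f_pos by auto
  define K where "K = b * f"
  have K: "1 \<le> K" using bf by (simp add: K_def)
  have st_f: "st * f \<le> W" "st * f div st = f"
    using le_trans[OF mult_le_mono1[OF st(2), of f] W(1)] st by auto
  have rest: "run S W (If (Op Less (cell 6) (cell 3)) send_com Skip) (m', []) r ?Q"
    if m': "reduced st x m'" "\<And>a. a \<notin> {9, 10, 11} \<Longrightarrow> (\<forall>c. a \<noteq> 18 + 4 * c) \<Longrightarrow> m' a = m a"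
      and r: "600 * (b * f) \<le> r" for m' r
  proof (rule run_If)
    have c': "m' 0 = Num x" "m' 3 = Num q" "m' 5 = Num f" "m' 6 = Num st" "m' 7 = Num cnt"
      using m'(2)[of 0] m'(2)[of 3] m'(2)[of 5] m'(2)[of 6] m'(2)[of 7] m by (auto simp: consts_ok_def)
    show "eval S W (fst (m', [])) (Op Less (cell 6) (cell 3)) = Some (Num (if st < q then 1 else 0))"
      using S c' by (simp add: num_word_def)
    have "600 \<le> r" using r bf by linarith
    then show "1 + cost (Op Less (cell 6) (cell 3)) \<le> r" by simp
    {
      assume "(if st < q then 1 else 0 :: nat) \<noteq> 0"
      then have lt: "st < q" by (simp split: if_splits)
      show "run S W send_com (m', []) (r - (1 + cost (Op Less (cell 6) (cell 3)))) ?Q"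
      proof (rule run_conseq[OF run_send])
        show "next_size st = min (st * f) q" by (simp add: next_size_def)
        show "(f div st + 1) * 100 + 60 \<le> r - (1 + cost (Op Less (cell 6) (cell 3)))"
        proof -
          have "f div st \<le> f" by simp
          with bf have "100 * (f div st) + 166 \<le> 600 * (b * f)" by linarith
          then show ?thesis using r by simp
        qed
      next
        fix s' :: "'a memory \<times> 'a message list" and r' :: nat
        assume "case s' of (m'', out') \<Rightarrow>
          (\<exists>ss. out' = [] @ map (msg st (next_size st) x m') ss \<and> distinct ss \<and>
             set ss = {s. s < f \<and> s mod st = x mod st}) \<and>
          m'' 6 = Num (next_size st) \<and> m'' 7 = Num (next_size st div st) \<and> (\<forall>a. a \<notin> {6, 7, 8, 9} \<longrightarrow> m'' a = m' a)"
        then obtain m'' ss where s': "s' = (m'', map (msg st (next_size st) x m') ss)" and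
          ss: "distinct ss" "set ss = {s. s < f \<and> s mod st = x mod st}" and
          m'': "m'' 6 = Num (next_size st)" "m'' 7 = Num (next_size st div st)"
            "\<And>a. a \<notin> {6, 7, 8, 9} \<Longrightarrow> m'' a = m' a" by auto
        \<comment> \<open>Sending leaves the partial minima intact, so the messages can be described
          by the final memory, the only one visible at network level.\<close>
        have C: "m'' (18 + 4 * i) = m' (18 + 4 * i)" for i using m''(3)[of "18 + 4 * i"] by simp
        have "msg st (next_size st) x m' = msg st (next_size st) x m''"
          by (simp add: msg_def fun_eq_iff C)
        moreover have "reduced st x m''" using m'(1) by (simp add: reduced_def C)
        moreover have "\<forall>a. a \<notin> {6, 7, 8, 9, 10, 11} \<longrightarrow> (\<forall>c. a \<noteq> 18 + 4 * c) \<longrightarrow> m'' a = m a"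
          using m''(3) m'(2) by auto
        ultimately show "?Q s' r'" unfolding s' using ss m'' lt by auto
      qed (use S W c' st x lt f_pos st_f in auto)
    }
    {
      assume "(if st < q then 1 else 0 :: nat) = 0"
      then have eq: "st = q" using st by (simp split: if_splits)
      then have ns: "next_size st = st" using f_pos by (simp add: next_size_def)
      show "run S W Skip (m', []) (r - (1 + cost (Op Less (cell 6) (cell 3)))) ?Q"
        by (rule run_Skip) (use m' eq ns c' \<open>600 \<le> r\<close> in auto)
    }
  qed
  have rest': "run S W (If (Op Less (cell 6) (cell 3)) send_com Skip) s' r ?Q"
    if s': "case s' of (m', out') \<Rightarrow> out' = [] \<and> reduced st x m' \<and>
          (\<forall>a. a \<notin> {9, 10, 11} \<longrightarrow> (\<forall>c. a \<noteq> 18 + 4 * c) \<longrightarrow> m' a = m a)"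
      and r: "1000 * (b * f) - (1 + cost (cell 7)) - 300 * (b * f) \<le> r" for s' r
  proof -
    obtain m' where m': "s' = (m', [])" "reduced st x m'"
      "\<And>a. a \<notin> {9, 10, 11} \<Longrightarrow> (\<forall>c. a \<noteq> 18 + 4 * c) \<Longrightarrow> m' a = m a"
      using s' by (cases s') auto
    have "600 * (b * f) \<le> r" using r K by (simp flip: K_def)
    show ?thesis unfolding m'(1)
      by (rule rest) (use m' \<open>600 * (b * f) \<le> r\<close> in auto)
  qed
  show ?thesis
    unfolding round_com_def
  proof (rule run_Seq, rule run_If)
    show "eval S W (fst (m, [])) (cell 7) = Some (Num cnt)"
      using S m by (simp add: num_word_def)
    show "1 + cost (cell 7) \<le> 1000 * (b * f)" using K by (simp flip: K_def)
  next
    assume "cnt \<noteq> 0"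
    show "run S W (combine 7 reduce_src) (m, []) (1000 * (b * f) - (1 + cost (cell 7)))
      (\<lambda>s' T'. run S W (If (Op Less (cell 6) (cell 3)) send_com Skip) s' T' ?Q)"
    proof (rule run_conseq[OF run_reduce[where cnt = cnt]])
      show "300 * (b * f) \<le> 1000 * (b * f) - (1 + cost (cell 7))" using K by (simp flip: K_def)
    next
      fix s' :: "'a memory \<times> 'a message list" and r :: nat
      assume "case s' of (m', out') \<Rightarrow> out' = [] \<and> reduced st x m' \<and>
          (\<forall>a. a \<notin> {9, 10, 11} \<longrightarrow> (\<forall>c. a \<noteq> 18 + 4 * c) \<longrightarrow> m' a = m a)"
        and "1000 * (b * f) - (1 + cost (cell 7)) - 300 * (b * f) \<le> r"
      then show "run S W (If (Op Less (cell 6) (cell 3)) send_com Skip) s' r ?Q" by (rule rest')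
    qed (use m st x \<open>cnt \<noteq> 0\<close> in auto)
  next
    assume "cnt = 0"
    with m have "st = 1" by (simp add: received_def)
    show "run S W (combine 4 product_src) (m, []) (1000 * (b * f) - (1 + cost (cell 7)))
      (\<lambda>s' T'. run S W (If (Op Less (cell 6) (cell 3)) send_com Skip) s' T' ?Q)"
    proof (rule run_conseq[OF run_product])
      show "300 * (b * f) \<le> 1000 * (b * f) - (1 + cost (cell 7))" using K by (simp flip: K_def)
    next
      fix s' :: "'a memory \<times> 'a message list" and r :: nat
      assume "case s' of (m', out') \<Rightarrow> out' = [] \<and> reduced st x m' \<and>
          (\<forall>a. a \<notin> {9, 10, 11} \<longrightarrow> (\<forall>c. a \<noteq> 18 + 4 * c) \<longrightarrow> m' a = m a)"
        and "1000 * (b * f) - (1 + cost (cell 7)) - 300 * (b * f) \<le> r"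
      then show "run S W (If (Op Less (cell 6) (cell 3)) send_com Skip) s' r ?Q"
        by (rule rest')
    qed (use m x \<open>st = 1\<close> in auto)
  qed
qed

end

section \<open>Finding the grid by doubling\<close>

definition setup_com :: com where
  "setup_com =
    Seq (Store (Const 3) (Const 1))
   (Seq (While (Op Less (Op Mult (Op Mult (Op Mult (Const 8) (cell 3)) (cell 3)) (cell 3)) (Op Add (cell 2) (Const 1)))
          (Store (Const 3) (Op Mult (Const 2) (cell 3))))
   (Seq (Store (Const 4) (Const 1))
   (Seq (While (Op Less (Op Mult (cell 3) (cell 4)) (cell 1))
          (Store (Const 4) (Op Mult (Const 2) (cell 4))))
   (Seq (Store (Const 5) (Op Mult (cell 4) (cell 4)))
        (Store (Const 6) (Const 1))))))"

text \<open>Cell 3 is 0 only before the first round and thus doubles as the flag for the setup.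
  Machines numbered \<open>q * q * q\<close> and above stay idle, as \<open>p\<close> need not be
  the cube of a power of two.\<close>

definition distance_com :: com where
  "distance_com = Seq (If (cell 3) Skip setup_com)
     (If (Op Less (cell 0) (Op Mult (Op Mult (cell 3) (cell 3)) (cell 3))) round_com Skip)"

text \<open>\<alpha> and \<beta> are the iteration counts. As only strict comparison exists, the
  test whether the doubled \<open>q\<close> still has a cube of at most \<open>p\<close> compares
  with \<open>p + 1\<close>. Its left side is at most 8 times a cube not exceeding \<open>p\<close>,
  hence \<open>8 * p + 8 \<le> W\<close>.\<close>

lemma run_init:
  fixes m :: "'a :: linordered_ab_semigroup_add memory"
  assumes S: "16 \<le> S" "16 \<le> W" and m: "m 1 = Num n" "m 2 = Num p"
    and q: "8 ^ \<alpha> \<le> p" "p < 8 ^ Suc \<alpha>"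
    and b: "\<And>i. i < \<beta> \<Longrightarrow> 2 ^ \<alpha> * 2 ^ i < n" "n \<le> 2 ^ \<alpha> * 2 ^ \<beta>"
    and W: "8 * p + 8 \<le> W" "2 * n \<le> W" "2 ^ \<alpha> * 2 ^ \<beta> \<le> W" "2 ^ \<beta> * 2 ^ \<beta> \<le> W"
  shows "run S W setup_com (m, out) (40 * (\<alpha> + \<beta>) + 60)
    (\<lambda>s' _. s' = (m(3 := Num (2 ^ \<alpha>), 4 := Num (2 ^ \<beta>), 5 := Num (2 ^ \<beta> * 2 ^ \<beta>), 6 := Num 1), out))"
    (is "run S W setup_com _ _ ?Q")
proof -
  define m3 where "m3 = m(3 := Num (2 ^ \<alpha>))"
  define m4 where "m4 = m3(4 := Num (2 ^ \<beta>))"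
  define P where "P = (\<lambda>i s. s = (m(3 := Num (2 ^ i)), out))"
  define P' where "P' = (\<lambda>i s. s = (m3(4 := Num (2 ^ i)), out))"
  let ?g = "Op Less (Op Mult (Op Mult (Op Mult (Const 8) (cell 3)) (cell 3)) (cell 3)) (Op Add (cell 2) (Const 1))"
  let ?g' = "Op Less (Op Mult (cell 3) (cell 4)) (cell 1)"
  have cube: "8 * 2 ^ i * 2 ^ i * 2 ^ i = (8 ^ Suc i :: nat)" for i
    by (simp add: power_mult_distrib[symmetric] mult.assoc)
  have g: "eval S W (m(3 := Num (2 ^ i))) ?g = Some (Num (if 8 ^ Suc i \<le> p then 1 else 0))" if "i \<le> \<alpha>" for i
  proof -
    have "(8::nat) ^ i \<le> 8 ^ \<alpha>" using that by (intro power_increasing) auto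
    from this q(1) have "8 ^ i \<le> p" by (rule le_trans)
    then have le: "8 ^ Suc i \<le> 8 * p" by simp
    define z where "z = (2::nat) ^ i"
    have "8 * z * z * z \<le> 8 * p" using le cube[of i] by (simp add: z_def)
    moreover have "1 \<le> z" by (simp add: z_def)
    moreover have "8 * z \<le> 8 * z * z" "8 * z * z \<le> 8 * z * z * z" using \<open>1 \<le> z\<close> by auto
    ultimately have bnd: "8 * z * z * z \<le> W" "8 * z * z \<le> W" "8 * z \<le> W" "p + 1 \<le> W" "8 \<le> W" "1 \<le> W"
      using W(1) by linarith+
    have v: "eval S W (m(3 := Num z)) (cell 3) = Some (Num z)"
      "eval S W (m(3 := Num z)) (cell 2) = Some (Num p)"
      using S m by (simp_all add: num_word_def)
    show ?thesis
      unfolding cube[symmetric] z_def[symmetric] eval.simps(3) v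
      using bnd by (simp add: num_word_def)
  qed
  have g': "eval S W (m3(4 := Num (2 ^ i))) ?g' = Some (Num (if 2 ^ \<alpha> * 2 ^ i < n then 1 else 0))" if "i \<le> \<beta>" for i
  proof -
    have "(2::nat) ^ \<alpha> * 2 ^ i \<le> 2 ^ \<alpha> * 2 ^ \<beta>" using that by (intro mult_le_mono2 power_increasing) auto
    with W have "(2::nat) ^ \<alpha> * 2 ^ i \<le> W" by linarith
    then show ?thesis using S m by (simp add: num_word_def m3_def)
  qed
  have tail: "run S W (Seq (Store (Const 5) (Op Mult (cell 4) (cell 4))) (Store (Const 6) (Const 1))) (m4, out) T ?Q"
    if "20 \<le> T" for T
  proof (rule run_Seq, rule run_Store[where a = 5 and v = "Num (2 ^ \<beta> * 2 ^ \<beta>)"])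
    show "eval S W m4 (Op Mult (cell 4) (cell 4)) = Some (Num (2 ^ \<beta> * 2 ^ \<beta>))"
      using S W by (simp add: num_word_def m4_def)
    show "run S W (Store (Const 6) (Const 1)) (m4(5 := Num (2 ^ \<beta> * 2 ^ \<beta>)), out)
       (T - (1 + cost (Const 5) + cost (Op Mult (cell 4) (cell 4)))) ?Q"
      by (rule run_Store[where a = 6 and v = "Num 1"])
         (use S that in \<open>simp_all add: num_word_def m4_def m3_def\<close>)
  qed (use S that in \<open>simp_all add: num_word_def\<close>)
  have loop': "run S W (Seq (While ?g' (Store (Const 4) (Op Mult (Const 2) (cell 4))))
     (Seq (Store (Const 5) (Op Mult (cell 4) (cell 4))) (Store (Const 6) (Const 1)))) (m3(4 := Num 1), out) T ?Q"
    if T: "40 * \<beta> + 35 \<le> T" for T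
  proof (rule run_Seq, rule run_While[where P = P' and N = \<beta> and Tb = 6])
    show "P' 0 (m3(4 := Num 1), out)" by (simp add: P'_def)
  next
    fix i s assume i: "i < \<beta>" and "P' i s"
    then have s: "s = (m3(4 := Num (2 ^ i)), out)" by (simp add: P'_def)
    have "(2::nat) ^ i \<le> 2 ^ \<alpha> * 2 ^ i" by simp
    with b(1)[OF i] W(2) have le: "2 * (2::nat) ^ i \<le> W" by linarith
    have "run S W (Store (Const 4) (Op Mult (Const 2) (cell 4))) s 6 (\<lambda>s' _. P' (Suc i) s')"
      unfolding s by (rule run_Store[where a = 4 and v = "Num (2 ^ Suc i)"])
        (use S le in \<open>simp_all add: num_word_def P'_def\<close>)
    then show "(\<exists>v. eval S W (fst s) ?g' = Some (Num v) \<and> v \<noteq> 0) \<and>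
       run S W (Store (Const 4) (Op Mult (Const 2) (cell 4))) s 6 (\<lambda>s' _. P' (Suc i) s')"
      using g'[of i] b(1)[OF i] i by (simp only: s fst_conv) simp
  next
    fix s assume "P' \<beta> s"
    then have s: "s = (m3(4 := Num (2 ^ \<beta>)), out)" by (simp add: P'_def)
    show "eval S W (fst s) ?g' = Some (Num 0)"
      using g'[of \<beta>] b(2) by (simp only: s fst_conv) simp
  next
    show "\<beta> * (1 + cost ?g' + 6) + 1 + cost ?g' \<le> T" using T by simp
  next
    fix s' :: "'a memory \<times> 'a message list" and r :: nat
    assume "P' \<beta> s'" and r: "T - (\<beta> * (1 + cost ?g' + 6) + 1 + cost ?g') \<le> r"
    then have s: "s' = (m4, out)" by (simp add: P'_def m4_def)
    show "run S W (Seq (Store (Const 5) (Op Mult (cell 4) (cell 4))) (Store (Const 6) (Const 1))) s' r ?Q"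
      unfolding s by (rule tail) (use r T in simp)
  qed
  have loop: "run S W (Seq (While ?g (Store (Const 3) (Op Mult (Const 2) (cell 3))))
   (Seq (Store (Const 4) (Const 1))
   (Seq (While ?g' (Store (Const 4) (Op Mult (Const 2) (cell 4))))
     (Seq (Store (Const 5) (Op Mult (cell 4) (cell 4))) (Store (Const 6) (Const 1)))))) (m(3 := Num 1), out) T ?Q"
    if T: "40 * (\<alpha> + \<beta>) + 57 \<le> T" for T
  proof (rule run_Seq, rule run_While[where P = P and N = \<alpha> and Tb = 6])
    show "P 0 (m(3 := Num 1), out)" by (simp add: P_def)
  next
    fix i s assume i: "i < \<alpha>" and "P i s"
    then have s: "s = (m(3 := Num (2 ^ i)), out)" by (simp add: P_def)
    have "(8::nat) ^ Suc i \<le> 8 ^ \<alpha>" using i by (intro power_increasing) auto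
    then have p: "8 ^ Suc i \<le> p" using q by linarith
    have "(2::nat) ^ Suc i \<le> 8 ^ Suc i" by (rule power_mono) auto
    with p W(1) have le: "2 * (2::nat) ^ i \<le> W" by simp
    have "run S W (Store (Const 3) (Op Mult (Const 2) (cell 3))) s 6 (\<lambda>s' _. P (Suc i) s')"
      unfolding s by (rule run_Store[where a = 3 and v = "Num (2 ^ Suc i)"])
        (use S le in \<open>simp_all add: num_word_def P_def\<close>)
    then show "(\<exists>v. eval S W (fst s) ?g = Some (Num v) \<and> v \<noteq> 0) \<and>
       run S W (Store (Const 3) (Op Mult (Const 2) (cell 3))) s 6 (\<lambda>s' _. P (Suc i) s')"
      using g[of i] p i by (simp only: s fst_conv) simp
  next
    fix s assume "P \<alpha> s"
    then have s: "s = (m(3 := Num (2 ^ \<alpha>)), out)" by (simp add: P_def)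
    show "eval S W (fst s) ?g = Some (Num 0)"
      using g[of \<alpha>] q(2) by (simp only: s fst_conv) simp
  next
    show "\<alpha> * (1 + cost ?g + 6) + 1 + cost ?g \<le> T" using T by simp
  next
    fix s' :: "'a memory \<times> 'a message list" and r :: nat
    assume "P \<alpha> s'" and r: "T - (\<alpha> * (1 + cost ?g + 6) + 1 + cost ?g) \<le> r"
    then have s: "s' = (m3, out)" by (simp add: P_def m3_def)
    have r: "40 * \<beta> + 38 \<le> r" using r T by simp
    show "run S W (Seq (Store (Const 4) (Const 1))
     (Seq (While ?g' (Store (Const 4) (Op Mult (Const 2) (cell 4))))
     (Seq (Store (Const 5) (Op Mult (cell 4) (cell 4))) (Store (Const 6) (Const 1))))) s' r ?Q"
      unfolding s
      apply (rule run_Seq, rule run_Store[where a = 4 and v = "Num 1"])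
      subgoal using S by (simp add: num_word_def)
      subgoal using S by simp
      subgoal using S by (simp add: num_word_def)
      subgoal using r by simp
      subgoal by (rule loop') (use r in simp)
      done
  qed
  show ?thesis
    unfolding setup_com_def
    apply (rule run_Seq, rule run_Store[where a = 3 and v = "Num 1"])
    subgoal using S by (simp add: num_word_def)
    subgoal using S by simp
    subgoal using S by (simp add: num_word_def)
    subgoal by simp
    subgoal by (rule loop) simp
    done
qed

section \<open>Rounds of the whole network\<close>

definition address :: "'a message \<Rightarrow> nat \<times> nat" where
  "address = (\<lambda>(d, a, v). (d, a))"

lemma distinct_concat_map_upt:
  assumes "\<And>i. i < p \<Longrightarrow> distinct (h i)"
    "\<And>i j. i < j \<Longrightarrow> j < p \<Longrightarrow> set (h i) \<inter> set (h j) = {}"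
  shows "distinct (concat (map h [0..<p]))"
  using assms
proof (induction p)
  case (Suc p)
  then have "distinct (concat (map h [0..<p]))" by simp
  moreover have "distinct (h p)" using Suc.prems(1) by simp
  moreover have "set (h i) \<inter> set (h p) = {}" if "i < p" for i using Suc.prems(2)[of i p] that by simp
  ultimately show ?case by (auto simp: disjoint_iff)
qed simp

lemma set_inbox: "(a, v) \<in> set (inbox p out j) \<longleftrightarrow> (\<exists>i<p. (j, a, v) \<in> set (out i))"
  by (force simp: inbox_def)

lemma distinct_inbox:
  assumes "distinct (map address (concat (map out [0..<p])))"
  shows "distinct (map fst (inbox p out j))"
proof -
  have "distinct (map address (filter (\<lambda>msg. fst msg = j) (concat (map out [0..<p]))))"
    by (rule distinct_map_filter[OF assms])
  moreover have "map address (filter (\<lambda>msg. fst msg = j) xs) = map (Pair j) (map fst (map snd (filter (\<lambda>msg. fst msg = j) xs)))"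
    for xs :: "'a message list"
    by (induction xs) (auto simp: address_def)
  ultimately show ?thesis by (simp only: inbox_def distinct_map)
qed

text \<open>The bound on received words comes for free: the messages to one machine go to distinct
  cells below \<open>S\<close>.\<close>

lemma legal_exchangeI:
  assumes "distinct (map address (concat (map out [0..<p])))"
    and "\<And>i. i < p \<Longrightarrow> length (out i) \<le> S"
    and "\<And>i d a v. i < p \<Longrightarrow> (d, a, v) \<in> set (out i) \<Longrightarrow> d < p \<and> a < S"
  shows "legal_exchange p S out"
proof -
  have "length (inbox p out j) \<le> S" for j
  proof -
    have "set (map fst (inbox p out j)) \<subseteq> {..<S}"
    proof
      fix a assume "a \<in> set (map fst (inbox p out j))"
      then obtain v where "(a, v) \<in> set (inbox p out j)" by auto
      then obtain i where "i < p" "(j, a, v) \<in> set (out i)" by (auto simp: set_inbox)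
      with assms(3) show "a \<in> {..<S}" by blast
    qed
    then have "card (set (map fst (inbox p out j))) \<le> card {..<S}"
      by (intro card_mono) auto
    then have "card (set (map fst (inbox p out j))) \<le> S" by simp
    then show ?thesis
      using distinct_card[OF distinct_inbox[OF assms(1)]] by simp
  qed
  then show ?thesis
    unfolding legal_exchange_def using assms(2,3) distinct_inbox[OF assms(1)] by blast
qed

lemma deliver_message:
  assumes "distinct (map address (concat (map out [0..<p])))" "i < p" "(j, a, v) \<in> set (out i)"
  shows "deliver m (inbox p out j) a = v"
proof -
  have "map_of (inbox p out j) a = Some v"
    using assms distinct_inbox by (intro map_of_is_SomeI) (auto simp: set_inbox)
  then show ?thesis by (simp add: deliver_def)
qed

lemma deliver_no_message:
  assumes "\<And>i v. i < p \<Longrightarrow> (j, a, v) \<notin> set (out i)"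
  shows "deliver m (inbox p out j) a = m a"
proof -
  have "map_of (inbox p out j) a = None"
    using assms by (auto simp: map_of_eq_None_iff set_inbox)
  then show ?thesis by (simp add: deliver_def)
qed

text \<open>The address determines everything digit by digit. The machine gives
  \<open>x div st'\<close> and \<open>s mod st'\<close>. The slot gives \<open>s div st'\<close> and
  \<open>x mod st' div st\<close>, because the latter is below \<open>st' div st\<close>. Now
  \<open>s\<close> is known, and the last digit \<open>x mod st\<close> equals
  \<open>s mod st\<close> because the sender is in charge of \<open>s\<close>.\<close>

lemma address_msg_inj:
  assumes "0 < st" "st dvd st'" "0 < st'" "s mod st = x mod st" "s' mod st = y mod st"
    and "address (msg st st' x m s) = address (msg st st' y m' s')"
  shows "x = y \<and> s = s'"
proof -
  obtain c where c: "st' = c * st" using assms(2) by (metis dvdE mult.commute)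
  have c_pos: "0 < c" "st' div st = c" using c assms by auto
  have lt: "z mod st' div st < c" for z
    using assms(3) c by (intro less_mult_imp_div_less) (simp add: mod_less_divisor)
  have e1: "x div st' * st' + s mod st' = y div st' * st' + s' mod st'"
    and e2: "s div st' * c + x mod st' div st = s' div st' * c + y mod st' div st"
    using assms(6) by (auto simp: msg_def address_def c_pos)
  have X: "x div st' = y div st'"
    using arg_cong[OF e1, of "\<lambda>z. z div st'"] assms(3) by simp
  have s: "s mod st' = s' mod st'"
    using arg_cong[OF e1, of "\<lambda>z. z mod st'"] assms(3) by simp
  have sd: "s div st' = s' div st'"
    using arg_cong[OF e2, of "\<lambda>z. z div c"] c_pos lt by simp
  have xd: "x mod st' div st = y mod st' div st" using e2 sd by simp
  have eq: "s = s'" using s sd by (metis div_mult_mod_eq)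
  then have "x mod st = y mod st" using assms by simp
  then have "x mod st' mod st = y mod st' mod st" using assms(2) by (simp add: mod_mod_cancel)
  with xd have "x mod st' = y mod st'" by (metis div_mult_mod_eq)
  with X have "x = y" by (metis div_mult_mod_eq)
  with eq show ?thesis by simp
qed

section \<open>Invariants of the network\<close>

locale power_grid = grid +
  fixes p \<alpha> \<beta> :: nat
  assumes q_power: "q = 2 ^ \<alpha>" and b_power: "b = 2 ^ \<beta>" and p: "q * q * q \<le> p"
begin

text \<open>Idle machines must have the constants too: from \<open>q\<close> they see that the setup
  is done and that they are idle.\<close>

definition state_ok :: "nat \<Rightarrow> nat \<Rightarrow> (nat \<Rightarrow> 'a memory) \<Rightarrow> bool" where
  "state_ok st cnt M \<longleftrightarrow> (\<forall>x<p. consts_ok x (M x)) \<and>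
     (\<forall>x<q * q * q. blocks_ok x (M x) \<and> M x 6 = Num st \<and> M x 7 = Num cnt \<and> received st cnt x (M x))"

definition pow2 :: "nat \<Rightarrow> bool" where "pow2 st \<longleftrightarrow> (\<exists>k. st = 2 ^ k)"

lemma pow2_dvd: "pow2 x \<Longrightarrow> pow2 y \<Longrightarrow> x \<le> y \<Longrightarrow> x dvd y"
  by (auto simp: pow2_def intro!: le_imp_power_dvd)

lemma pow2_q: "pow2 q" using q_power by (auto simp: pow2_def)

lemma pow2_f: "pow2 f" unfolding pow2_def f_def b_power by (metis power_add)

lemma pow2_mult: "pow2 x \<Longrightarrow> pow2 y \<Longrightarrow> pow2 (x * y)"
  unfolding pow2_def by (metis power_add)

lemma pow2_next_size: "pow2 st \<Longrightarrow> pow2 (next_size st)"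
  by (simp add: next_size_def min_def pow2_q pow2_mult pow2_f)

lemma pow2_pos: "pow2 st \<Longrightarrow> 0 < st" by (auto simp: pow2_def)

text \<open>\<open>M0\<close> is the memory at the start of the round and \<open>M\<close> the one
  after the optional setup. This covers the first round, where \<open>Ti\<close> pays for the setup,
  as well as later ones, where both coincide.\<close>

lemma mr_round_prog:
  assumes M: "state_ok st cnt M" and st: "pow2 st" "st \<le> q"
    and start: "\<And>x. x < p \<Longrightarrow> run S W (If (cell 3) Skip setup_com) (M0 x, []) Ti (\<lambda>s' _. s' = (M x, []))"
  shows "\<exists>t M' cnt'. mr_round p S W distance_com M0 t M' \<and> t \<le> p * (Ti + 1000 * (b * f) + 20) \<and>
    (\<forall>x<q * q * q. reduced st x (M' x)) \<and> state_ok (next_size st) cnt' M'"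
proof -
  define st' where "st' = next_size st"
  define cnt' where "cnt' = (if st < q then st' div st else cnt)"
  have pos: "0 < st" "0 < st'" using st pow2_next_size[OF st(1)] by (auto simp: st'_def intro: pow2_pos)
  have le: "st \<le> st'" "st' \<le> q" "st' \<le> st * f" if "st < q"
    using that f_pos by (auto simp: st'_def next_size_def)
  have st'_q: "st' \<le> q" by (simp add: st'_def next_size_def)
  have dvd: "st dvd st'" "st' dvd q"
  proof -
    have "st \<le> st'" using f_pos st by (auto simp: st'_def next_size_def)
    then show "st dvd st'" "st' dvd q"
      using st st'_q pow2_q pow2_next_size[OF st(1)] by (auto simp: st'_def intro!: pow2_dvd)
  qed
  define R where "R = (\<lambda>x (m', out).
     (x < q * q * q \<longrightarrow> reduced st x m' \<and> m' 6 = Num st' \<and> m' 7 = Num cnt') \<and>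
     (\<forall>a. a \<notin> {6, 7, 8, 9, 10, 11} \<longrightarrow> (\<forall>c. a \<noteq> 18 + 4 * c) \<longrightarrow> m' a = M x a) \<and>
     (\<exists>ss. out = map (msg st st' x m') ss \<and> distinct ss \<and>
          set ss = {s. x < q * q * q \<and> st < q \<and> s < f \<and> s mod st = x mod st}))"
  have local: "\<exists>t m' out. exec S W distance_com (M0 x, []) t (m', out) \<and> t \<le> Ti + 1000 * (b * f) + 20 \<and> R x (m', out)"
    if x: "x < p" for x
  proof -
    have c: "M x 0 = Num x" "M x 3 = Num q" using M x by (auto simp: state_ok_def consts_ok_def)
    have guard: "eval S W (M x) (Op Less (cell 0) (Op Mult (Op Mult (cell 3) (cell 3)) (cell 3))) =
        Some (Num (if x < q * q * q then 1 else 0))"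
    proof -
      have "q * q \<le> q * q * q" using q_pos by simp
      then have "q * q \<le> W" "q * q * q \<le> W" using W by linarith+
      then show ?thesis using S c by (simp add: num_word_def)
    qed
    have "run S W distance_com (M0 x, []) (Ti + 1000 * (b * f) + 20) (\<lambda>s' _. R x s')"
      unfolding distance_com_def
    proof (rule run_Seq, rule run_conseq[OF start[OF x]])
      fix s' :: "'a memory \<times> 'a message list" and r :: nat
      assume s': "s' = (M x, [])" and r: "Ti + 1000 * (b * f) + 20 - Ti \<le> r"
      show "run S W (If (Op Less (cell 0) (Op Mult (Op Mult (cell 3) (cell 3)) (cell 3))) round_com Skip) s' r
         (\<lambda>s' _. R x s')"
        unfolding s'
      proof (rule run_If, subst fst_conv, rule guard)
        show "1 + cost (Op Less (cell 0) (Op Mult (Op Mult (cell 3) (cell 3)) (cell 3))) \<le> r"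
          using r by simp
      next
        assume "(if x < q * q * q then 1 else 0 :: nat) \<noteq> 0"
        then have xq: "x < q * q * q" by (simp split: if_splits)
        show "run S W round_com (M x, []) (r - (1 + cost (Op Less (cell 0) (Op Mult (Op Mult (cell 3) (cell 3)) (cell 3)))))
           (\<lambda>s' _. R x s')"
        proof (rule run_conseq[OF run_body[where st = st and cnt = cnt and x = x]])
          show "1000 * (b * f) \<le> r - (1 + cost (Op Less (cell 0) (Op Mult (Op Mult (cell 3) (cell 3)) (cell 3))))"
            using r by simp
        next
          fix s' :: "'a memory \<times> 'a message list"
          assume "case s' of (m', out) \<Rightarrow> reduced st x m' \<and>
             m' 6 = Num (next_size st) \<and> m' 7 = Num (if st < q then next_size st div st else cnt) \<and>
             (\<forall>a. a \<notin> {6, 7, 8, 9, 10, 11} \<longrightarrow> (\<forall>c. a \<noteq> 18 + 4 * c) \<longrightarrow> m' a = M x a) \<and>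
             (\<exists>ss. out = map (msg st (next_size st) x m') ss \<and> distinct ss \<and>
                set ss = {s. st < q \<and> s < f \<and> s mod st = x mod st})"
          then show "R x s'" using xq unfolding R_def st'_def cnt'_def
            by (cases s') (simp only: prod.case simp_thms, blast)
        qed (use M x xq pos st in \<open>auto simp: state_ok_def\<close>)
      next
        assume "(if x < q * q * q then 1 else 0 :: nat) = 0"
        then have "\<not> x < q * q * q" by (simp split: if_splits)
        then have "R x (M x, [])" by (simp add: R_def)
        then show "run S W Skip (M x, []) (r - (1 + cost (Op Less (cell 0) (Op Mult (Op Mult (cell 3) (cell 3)) (cell 3)))))
           (\<lambda>s' _. R x s')"
          by (intro run_Skip) (use r in simp_all)
      qed
    qed simp
    then show ?thesis unfolding run_def by (metis surj_pair)
  qed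
  then obtain time M1 out where run: "\<And>x. x < p \<Longrightarrow> exec S W distance_com (M0 x, []) (time x) (M1 x, out x)"
    and time: "\<And>x. x < p \<Longrightarrow> time x \<le> Ti + 1000 * (b * f) + 20" and R: "\<And>x. x < p \<Longrightarrow> R x (M1 x, out x)"
    by metis
  have "\<forall>x. \<exists>ss. x < p \<longrightarrow> out x = map (msg st st' x (M1 x)) ss \<and> distinct ss \<and>
          set ss = {s. x < q * q * q \<and> st < q \<and> s < f \<and> s mod st = x mod st}"
    using R unfolding R_def by blast
  then obtain ss where "\<forall>x. x < p \<longrightarrow> out x = map (msg st st' x (M1 x)) (ss x) \<and> distinct (ss x) \<and>
      set (ss x) = {s. x < q * q * q \<and> st < q \<and> s < f \<and> s mod st = x mod st}"
    by (rule choice[THEN exE])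
  then have out: "\<And>x. x < p \<Longrightarrow> out x = map (msg st st' x (M1 x)) (ss x)"
    and ss: "\<And>x. x < p \<Longrightarrow> distinct (ss x)"
      "\<And>x. x < p \<Longrightarrow> set (ss x) = {s. x < q * q * q \<and> st < q \<and> s < f \<and> s mod st = x mod st}"
    by blast+
  have dist: "distinct (map address (concat (map out [0..<p])))"
  proof -
    have "distinct (concat (map (\<lambda>x. map address (out x)) [0..<p]))"
    proof (rule distinct_concat_map_upt)
      fix x assume x: "x < p"
      have "inj_on (\<lambda>s. address (msg st st' x (M1 x) s)) (set (ss x))"
      proof (rule inj_onI)
        fix s s' assume "s \<in> set (ss x)" "s' \<in> set (ss x)"
          "address (msg st st' x (M1 x) s) = address (msg st st' x (M1 x) s')"
        then show "s = s'"
          using address_msg_inj[OF pos(1) dvd(1) pos(2)] by (metis (mono_tags, lifting) ss(2)[OF x] mem_Collect_eq)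
      qed
      then show "distinct (map address (out x))"
        using ss(1)[OF x] by (simp add: out[OF x] distinct_map comp_def)
    next
      fix x y assume xy: "x < y" "y < p"
      then have "x < p" by simp
      show "set (map address (out x)) \<inter> set (map address (out y)) = {}"
      proof (rule ccontr)
        assume "set (map address (out x)) \<inter> set (map address (out y)) \<noteq> {}"
        then obtain k where k: "k \<in> set (map address (out x))" "k \<in> set (map address (out y))" by blast
        from k(1) obtain s where s: "s \<in> set (ss x)" "k = address (msg st st' x (M1 x) s)"
          unfolding out[OF \<open>x < p\<close>] by auto
        from k(2) obtain s' where s': "s' \<in> set (ss y)" "k = address (msg st st' y (M1 y) s')"
          unfolding out[OF \<open>y < p\<close>] by auto
        from s(2) s'(2) have eq: "address (msg st st' x (M1 x) s) = address (msg st st' y (M1 y) s')" by simp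
        have "s mod st = x mod st" "s' mod st = y mod st"
          using s(1) s'(1) unfolding ss(2)[OF \<open>x < p\<close>] ss(2)[OF \<open>y < p\<close>] by simp_all
        from address_msg_inj[OF pos(1) dvd(1) pos(2) this eq] xy show False by simp
      qed
    qed
    moreover have "map address (concat (map out [0..<p])) = concat (map (\<lambda>x. map address (out x)) [0..<p])"
      by (simp add: map_concat comp_def)
    ultimately show ?thesis by simp
  qed
  \<comment> \<open>As \<open>st'\<close> divides the number of active machines, these form whole
    groups, and no message goes to an idle machine.\<close>
  have st'_dvd: "st' dvd q * q * q" using dvd(2) by simp
  then obtain K where K: "q * q * q = K * st'" by (metis dvdE mult.commute)
  have in_range: "z div st' * st' + r < q * q * q" if "z < q * q * q" "r < st'" for z r
  proof -
    have "z div st' < K" using that K by (simp add: less_mult_imp_div_less)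
    have "z div st' * st' + r < (z div st' + 1) * st'" using that by simp
    also have "\<dots> \<le> K * st'" using \<open>z div st' < K\<close> by (intro mult_le_mono1) simp
    finally show ?thesis using K by simp
  qed
  have legal: "legal_exchange p S out"
  proof (rule legal_exchangeI[OF dist])
    fix x assume x: "x < p"
    have "length (ss x) = card (set (ss x))" using ss(1)[OF x] by (simp add: distinct_card)
    also have "\<dots> \<le> card {..<f}" by (rule card_mono) (use ss(2)[OF x] in auto)
    finally show "length (out x) \<le> S" using S out[OF x] by simp
  next
    fix x d a v assume x: "x < p" and "(d, a, v) \<in> set (out x)"
    then obtain s where s: "x < q * q * q" "st < q" "s < f"
      "d = x div st' * st' + s mod st'" "a = 19 + 4 * (s div st' * (st' div st) + x mod st' div st)"
      using ss(2)[OF x] out[OF x] by (auto simp: msg_def)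
    have "d < q * q * q" using in_range[OF s(1)] s(4) pos by simp
    moreover have "s div st' * (st' div st) + x mod st' div st < 2 * f"
      using slot_less[OF pos(1) le(1,3) s(3)] s(2) by blast
    ultimately show "d < p \<and> a < S" using p S s(5) by auto
  qed
  define M' where "M' = (\<lambda>j. deliver (M1 j) (inbox p out j))"
  have round: "mr_round p S W distance_com M0 (\<Sum>x<p. time x) M'"
    unfolding mr_round_def using run legal by (auto simp: M'_def)
  have "(\<Sum>x<p. time x) \<le> of_nat (card {..<p}) * (Ti + 1000 * (b * f) + 20)"
    by (rule sum_bounded_above) (use time in auto)
  then have t: "(\<Sum>x<p. time x) \<le> p * (Ti + 1000 * (b * f) + 20)" by simp
  have unch: "M' x a = M1 x a" if "\<And>c. a \<noteq> 19 + 4 * c" for x a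
    unfolding M'_def
  proof (rule deliver_no_message)
    fix i v assume "i < p"
    show "(x, a, v) \<notin> set (out i)"
    proof
      assume "(x, a, v) \<in> set (out i)"
      then obtain s where "(x, a, v) = msg st st' i (M1 i) s" unfolding out[OF \<open>i < p\<close>] by auto
      then have "a = 19 + 4 * (s div st' * (st' div st) + i mod st' div st)" unfolding msg_def by blast
      with that show False by blast
    qed
  qed
  have unch2: "M' x a = M x a" if "x < p" "\<And>c. a \<noteq> 18 + 4 * c" "\<And>c. a \<noteq> 19 + 4 * c"
      "a \<notin> {6, 7, 8, 9, 10, 11}" for x a
    using unch[OF that(3)] R[OF that(1)] that(2,4) by (simp add: R_def)
  have unch3: "M' x a = M x a" if "x < p" "\<not> st < q" "\<And>c. a \<noteq> 18 + 4 * c"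
      "a \<notin> {6, 7, 8, 9, 10, 11}" for x a
  proof -
    have "M' x a = M1 x a" unfolding M'_def
      by (rule deliver_no_message) (use ss(2) that(2) out in auto)
    then show ?thesis using R[OF that(1)] that(3,4) by (simp add: R_def)
  qed
  have reduced: "reduced st x (M' x)" if x: "x < q * q * q" for x
  proof -
    have xp: "x < p" using x p by simp
    have "M' x (18 + 4 * s) = M1 x (18 + 4 * s)" for s by (rule unch) presburger
    then show ?thesis using R[OF xp] x by (simp add: R_def reduced_def)
  qed
  have ok: "consts_ok x (M' x)" if "x < p" for x
  proof -
    have "M' x a = M x a" if "a < 6" for a using that by (intro unch2 \<open>x < p\<close>) auto
    then show ?thesis using M \<open>x < p\<close> by (simp add: state_ok_def consts_ok_def)
  qed
  have blocks: "blocks_ok x (M' x)" if x: "x < q * q * q" for x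
  proof -
    have xp: "x < p" using x p by simp
    have "M' x (16 + 4 * u) = M x (16 + 4 * u)" for u by (rule unch2[OF xp]) (auto, presburger+)
    moreover have "M' x (17 + 4 * u) = M x (17 + 4 * u)" for u by (rule unch2[OF xp]) (auto, presburger+)
    ultimately show ?thesis using M x by (simp add: state_ok_def blocks_ok_def)
  qed
  have vars: "M' x 6 = Num st' \<and> M' x 7 = Num cnt'" if x: "x < q * q * q" for x
  proof -
    have xp: "x < p" using x p by simp
    have "M' x 6 = M1 x 6" "M' x 7 = M1 x 7" by (auto intro!: unch)
    then show ?thesis using R[OF xp] x by (simp add: R_def)
  qed
  have recv: "received st' cnt' y (M' y)" if y: "y < q * q * q" for y
  proof (cases "st < q")
    case False
    then have eq: "st' = st" "cnt' = cnt" using st f_pos by (auto simp: st'_def cnt'_def next_size_def)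
    have yp: "y < p" using y p by simp
    have "M' y (19 + 4 * u) = M y (19 + 4 * u)" for u by (rule unch3[OF yp False]) (auto, presburger+)
    then have "received st cnt y (M' y) \<longleftrightarrow> received st cnt y (M y)" by (simp only: received_def)
    then show ?thesis using M y by (simp add: eq state_ok_def)
  next
    case True
    obtain c where c: "st' = c * st" using dvd(1) by (metis dvdE mult.commute)
    have c': "0 < c" "c \<le> f" "cnt' = c" using c pos le[OF True] True
      by (auto simp: cnt'_def mult.commute)
    have msg: "M' y (19 + 4 * (s div st' * c + w)) = Entry (group_min st (y div st' * st' + w * st + s mod st) s)"
      if s: "s < f" "s mod st' = y mod st'" "w < c" for s w
    proof -
      \<comment> \<open>The sender of this slot: in the \<open>w\<close>-th old group within the new
        group of \<open>y\<close>, the member in charge of \<open>s\<close>.\<close>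
      define r where "r = w * st + s mod st"
      define x where "x = y div st' * st' + r"
      have "r < (w + 1) * st" using pos by (simp add: r_def)
      also have "\<dots> \<le> st'" unfolding c using s by (intro mult_le_mono1) simp
      finally have r: "r < st'" .
      have xq: "x < q * q * q" unfolding x_def by (rule in_range[OF y r])
      then have xp: "x < p" using p by simp
      have x_mod: "x mod st' = r" "x div st' = y div st'" using r pos by (simp_all add: x_def)
      have rd: "r div st = w" "r mod st = s mod st" using pos by (simp_all add: r_def)
      have xm: "x mod st = s mod st"
        using mod_mod_cancel[OF dvd(1), of x] x_mod rd by simp
      have y_eq: "y div st' * st' + s mod st' = y" using s by simp
      have C: "M1 x (18 + 4 * (s div st)) = Entry (group_min st x s)"
        using R[OF xp] xq s xm by (simp add: R_def reduced_def)
      have "msg st st' x (M1 x) s = (y, 19 + 4 * (s div st' * c + w), Entry (group_min st x s))"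
        using c pos x_mod rd C y_eq by (simp add: msg_def)
      moreover have "s \<in> set (ss x)" using ss(2)[OF xp] xq True s xm by simp
      ultimately have "(y, 19 + 4 * (s div st' * c + w), Entry (group_min st x s)) \<in> set (out x)"
        unfolding out[OF xp] by force
      then have "M' y (19 + 4 * (s div st' * c + w)) = Entry (group_min st x s)"
        unfolding M'_def by (rule deliver_message[OF dist xp])
      then show ?thesis by (simp add: x_def r_def add.assoc)
    qed
    show ?thesis
      unfolding received_def using c' pos c msg by auto
  qed
  have "state_ok st' cnt' M'"
    using ok blocks vars recv by (simp add: state_ok_def)
  then show ?thesis using round t reduced unfolding st'_def by blast
qed

text \<open>Capping at \<open>q\<close> after every step has the same effect as capping once at the
  end, since multiplication by \<open>f\<close> never decreases a size.\<close>

lemma next_size_power: "(next_size ^^ k) 1 = min (f ^ k) q"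
proof (induction k)
  case (Suc k)
  have "min (min (f ^ k) q * f) q = min (f ^ k * f) q"
  proof (cases "f ^ k \<le> q")
    case False
    have "q \<le> q * f" "f ^ k \<le> f ^ k * f" using f_pos by simp_all
    with False have "q \<le> f ^ k * f" by linarith
    with \<open>q \<le> q * f\<close> False show ?thesis by (simp only: min_def if_False if_True) auto
  qed (simp add: min_absorb1)
  then have "next_size (min (f ^ k) q) = min (f ^ Suc k) q"
    by (simp add: next_size_def mult.commute)
  with Suc.IH show ?case by simp
qed (use q_pos in simp)

text \<open>Each round reduces before it exchanges, so \<open>Suc R\<close> rounds account for
  \<open>R\<close> enlargements of the groups; this is the summand 1 in the number of rounds. Only
  the first round pays for the setup. Later ones pay 10 steps for the test, which turns the 20 of a
  round into 30.\<close>

lemma mr_run_prog: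
  assumes "state_ok st cnt M" "pow2 st" "st \<le> q"
    and "\<And>x. x < p \<Longrightarrow> run S W (If (cell 3) Skip setup_com) (M0 x, []) Ti (\<lambda>s' _. s' = (M x, []))"
  shows "\<exists>t M'. mr_run p S W distance_com (Suc R) M0 t M' \<and>
     t \<le> p * Ti + Suc R * (p * (1000 * (b * f) + 30)) \<and>
     (\<forall>x<q * q * q. reduced ((next_size ^^ R) st) x (M' x))"
  using assms
proof (induction R arbitrary: st cnt M M0 Ti)
  case 0
  then obtain t M' where "mr_round p S W distance_com M0 t M'" "t \<le> p * (Ti + 1000 * (b * f) + 20)"
    "\<forall>x<q * q * q. reduced st x (M' x)" using mr_round_prog by blast
  moreover from this have "mr_run p S W distance_com (Suc 0) M0 (t + 0) M'" by (blast intro: mr_run.intros)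
  ultimately show ?case by (auto simp: algebra_simps intro!: exI[of _ t] exI[of _ M'])
next
  case (Suc R)
  then obtain t1 M1 cnt1 where M1: "mr_round p S W distance_com M0 t1 M1" "t1 \<le> p * (Ti + 1000 * (b * f) + 20)"
    "state_ok (next_size st) cnt1 M1" using mr_round_prog by blast
  have skip: "run S W (If (cell 3) Skip setup_com) (M1 x, []) 10 (\<lambda>s' _. s' = (M1 x, []))" if "x < p" for x
  proof (rule run_If)
    show "eval S W (fst (M1 x, [])) (cell 3) = Some (Num q)"
      using M1(3) that S by (simp add: num_word_def state_ok_def consts_ok_def)
    show "run S W Skip (M1 x, []) (10 - (1 + cost (cell 3))) (\<lambda>s' _. s' = (M1 x, []))"
      by (rule run_Skip) auto
  qed (use q_pos in auto)
  have "next_size st \<le> q" by (simp add: next_size_def)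
  then obtain t2 M' where M': "mr_run p S W distance_com (Suc R) M1 t2 M'"
    "t2 \<le> p * 10 + Suc R * (p * (1000 * (b * f) + 30))"
    "\<forall>x<q * q * q. reduced ((next_size ^^ R) (next_size st)) x (M' x)"
    using Suc.IH[OF M1(3) pow2_next_size[OF Suc.prems(2)] _ skip] by blast
  have "mr_run p S W distance_com (Suc (Suc R)) M0 (t1 + t2) M'"
    using M1(1) M'(1) by (rule mr_run_Suc)
  moreover have "t1 + t2 \<le> p * Ti + Suc (Suc R) * (p * (1000 * (b * f) + 30))"
    using M1(2) M'(2) by (simp add: algebra_simps)
  moreover have "(next_size ^^ R) (next_size st) = (next_size ^^ Suc R) st"
    by (simp add: funpow_swap1)
  ultimately show ?case using M'(3) by metis
qed

end

section \<open>The distance product on a grid of machines\<close>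

text \<open>A group of size \<open>q\<close> contains every summation block for a fixed result
  block, so block number and inner index together run through all \<open>u < q * b\<close>. Every
  member has the same \<open>group_min\<close>; \<open>r\<close> is left free to be chosen as the
  one in charge of the position.\<close>

lemma (in grid) group_min_entry:
  assumes "x < q * b" "y < q * b" "r < q"
  shows "group_min q ((x div b * q + y div b) * q + r) (x mod b * b + y mod b) =
    (MIN u\<in>{..<q * b}. a x u + c u y)"
proof -
  let ?s = "x mod b * b + y mod b"
  let ?i = "x div b" and ?j = "y div b"
  have s: "?s div b = x mod b" "?s mod b = y mod b" using b_pos by auto
  have ij: "?i < q" "?j < q" using assms by (simp_all add: less_mult_imp_div_less)
  have bp: "block_prod ((?i * q + ?j) * q + t) ?s = (MIN w\<in>{..<b}. a x (t * b + w) + c (t * b + w) y)"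
    if t: "t < q" for t
  proof -
    let ?x = "(?i * q + ?j) * q + t"
    have d1: "?x div q = ?i * q + ?j" "?x mod q = t" using t by auto
    have d2: "?x div (q * q) = ?i" using d1 ij(2) by (simp add: div_mult2_eq)
    have "A_entry ?x (?s div b * b + w) = a x (t * b + w)" if "w < b" for w
      using that t by (simp add: A_entry_def d2 s)
    moreover have "B_entry ?x (w * b + ?s mod b) = c (t * b + w) y" if "w < b" for w
      using that t b_pos ij(2) by (simp add: B_entry_def s)
    ultimately show ?thesis by (simp add: block_prod_def)
  qed
  have "((?i * q + ?j) * q + r) div q * q = (?i * q + ?j) * q" using assms(3) by simp
  then have "group_min q ((?i * q + ?j) * q + r) ?s = (MIN t\<in>{..<q}. block_prod ((?i * q + ?j) * q + t) ?s)"
    by (simp only: group_min_def)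
  also have "\<dots> = (MIN t\<in>{..<q}. MIN w\<in>{..<b}. a x (t * b + w) + c (t * b + w) y)"
    by (simp add: bp)
  finally have "group_min q ((?i * q + ?j) * q + r) ?s =
      (MIN t\<in>{..<q}. MIN w\<in>{..<b}. a x (t * b + w) + c (t * b + w) y)" .
  then show ?thesis using Min_lessThan_mult[OF q_pos b_pos, of "\<lambda>u. a x u + c u y"] by simp
qed

text \<open>
  Indices are wrapped modulo \<open>n\<close>: there is no neutral entry to pad with, but repeating summation
  indices does not change a minimum, and the surplus rows and columns are never read.
\<close>

definition block_placement :: "nat \<Rightarrow> nat \<Rightarrow> nat \<Rightarrow> placement" where
  "block_placement n q b x a = (let u = (a - 16) div 4 in
     if x < q * q * q \<and> 16 \<le> a \<and> u < b * b then
       (if a mod 4 = 0 then Some (FromA ((x div (q * q) * b + u div b) mod n) ((x mod q * b + u mod b) mod n))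
        else if a mod 4 = 1 then Some (FromB ((x mod q * b + u div b) mod n) ((x div q mod q * b + u mod b) mod n))
        else None)
     else None)"

lemma image_mod_lessThan:
  fixes n m :: nat
  assumes "0 < n" "n \<le> m"
  shows "(\<lambda>u. u mod n) ` {..<m} = {..<n}"
proof
  show "{..<n} \<subseteq> (\<lambda>u. u mod n) ` {..<m}"
  proof
    fix u assume "u \<in> {..<n}"
    then have "u = u mod n" "u \<in> {..<m}" using assms by auto
    then show "u \<in> (\<lambda>u. u mod n) ` {..<m}" by (rule image_eqI)
  qed
qed (use assms in auto)

text \<open>The output location is the layout for group size \<open>q\<close>: within the machines
  of result block \<open>(x div b, y div b)\<close>, position
  \<open>s = x mod b * b + y mod b\<close> belongs to number \<open>s mod q\<close>, which keeps it
  at index \<open>s div q\<close>.\<close>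

lemma dist_prod_via_grid:
  fixes A B :: "'a :: linordered_ab_semigroup_add mat"
  assumes A: "A \<in> carrier_mat n n" and B: "B \<in> carrier_mat n n"
    and n: "0 < n" "n \<le> 2 ^ \<alpha> * 2 ^ \<beta>" "\<And>i. i < \<beta> \<Longrightarrow> 2 ^ \<alpha> * 2 ^ i < n"
    and p8: "8 ^ \<alpha> \<le> p" "p < 8 ^ Suc \<alpha>"
    and mem: "20 + 8 * (2 ^ \<beta> * 2 ^ \<beta>) \<le> S" "S \<le> W"
    and bounds: "8 * p + 8 \<le> W" "2 * n \<le> W" "2 ^ \<alpha> * (2 ^ \<beta> * 2 ^ \<beta>) \<le> W" "2 ^ \<alpha> + 2 ^ \<beta> * 2 ^ \<beta> \<le> W"
    and R: "2 ^ \<alpha> \<le> (2 ^ \<beta> * 2 ^ \<beta> :: nat) ^ R"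
  defines "q \<equiv> 2 ^ \<alpha>" and "b \<equiv> 2 ^ \<beta>"
  shows "\<exists>t M. mr_run p S W distance_com (Suc R) (init_mem n p (block_placement n q b) A B) t M \<and>
     holds_result p S (\<lambda>x y. ((x div b * q + y div b) * q + (x mod b * b + y mod b) mod q,
        18 + 4 * ((x mod b * b + y mod b) div q))) (A \<star> B) M \<and>
     t \<le> p * (40 * (\<alpha> + \<beta>) + 70) + Suc R * (p * (1000 * (b * (b * b)) + 30))"
proof -
  define a where "a i j = A $$ (i mod n, j mod n)" for i j
  define c where "c i j = B $$ (i mod n, j mod n)" for i j
  have q3: "q * q * q = 8 ^ \<alpha>"
    by (simp add: q_def power_mult_distrib[symmetric])
  have pos: "0 < q" "0 < b" by (simp_all add: q_def b_def)
  have q_le: "q \<le> p"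
  proof -
    have "q * 1 \<le> q * (q * q)" using pos by (intro mult_le_mono2) (simp add: Suc_le_eq)
    with p8(1) q3 show ?thesis by (metis le_trans mult.assoc mult.right_neutral)
  qed
  interpret power_grid q b "b * b" S W a c p \<alpha> \<beta>
  proof
    show "q * q * q + q \<le> W" using q3 q_le p8(1) bounds(1) by simp
  qed (use pos mem bounds p8 q3 in \<open>simp_all add: q_def b_def\<close>)
  let ?M0 = "init_mem n p (block_placement n q b) A B"
  \<comment> \<open>The memory after the setup. Cell 7 keeps its initial 0, which marks the product
    as still to be computed.\<close>
  define M where "M x = (?M0 x)(3 := Num q, 4 := Num b, 5 := Num (b * b), 6 := Num 1)" for x
  have M0: "?M0 x 0 = Num x" "?M0 x 1 = Num n" "?M0 x 2 = Num p" "?M0 x 3 = Num 0" "?M0 x 7 = Num 0" for x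
    by (simp_all add: init_mem_def block_placement_def)
  have blocks: "blocks_ok x (M x)" if "x < q * q * q" for x
    unfolding blocks_ok_def
  proof (intro allI impI conjI)
    fix u assume u: "u < b * b"
    have "(16 + 4 * u) mod 4 = 0" "(17 + 4 * u) mod 4 = 1" "(17 + 4 * u - 16) div 4 = u" by presburger+
    then have "block_placement n q b x (16 + 4 * u) = Some (FromA ((x div (q * q) * b + u div b) mod n) ((x mod q * b + u mod b) mod n))"
      "block_placement n q b x (17 + 4 * u) = Some (FromB ((x mod q * b + u div b) mod n) ((x div q mod q * b + u mod b) mod n))"
      using u that by (simp_all add: block_placement_def)
    then show "M x (16 + 4 * u) = Entry (A_entry x u)" "M x (17 + 4 * u) = Entry (B_entry x u)"
      by (simp_all add: M_def init_mem_def A_entry_def B_entry_def a_def c_def)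
  qed
  have ok: "state_ok 1 0 M"
    unfolding state_ok_def using blocks M0
    by (auto simp: consts_ok_def received_def M_def)
  have start: "run S W (If (cell 3) Skip setup_com) (?M0 x, []) (40 * (\<alpha> + \<beta>) + 70) (\<lambda>s' _. s' = (M x, []))" for x
  proof (rule run_If)
    show "eval S W (fst (?M0 x, [])) (cell 3) = Some (Num 0)"
      using mem M0(4)[of x] by (simp add: num_word_def)
    show "run S W setup_com (?M0 x, []) (40 * (\<alpha> + \<beta>) + 70 - (1 + cost (cell 3))) (\<lambda>s' _. s' = (M x, []))"
    proof (rule run_conseq[OF run_init[OF _ _ M0(2,3) p8 n(3,2)]])
      have "2 ^ \<alpha> * 2 ^ \<beta> \<le> 2 ^ \<alpha> * (2 ^ \<beta> * 2 ^ \<beta> :: nat)" by (intro mult_le_mono2) simp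
      then show "2 ^ \<alpha> * 2 ^ \<beta> \<le> W" using bounds(3) by linarith
    qed (use mem bounds in \<open>auto simp: M_def q_def b_def\<close>)
  qed auto
  obtain t M' where t: "mr_run p S W distance_com (Suc R) ?M0 t M'"
    "t \<le> p * (40 * (\<alpha> + \<beta>) + 70) + Suc R * (p * (1000 * (b * (b * b)) + 30))"
    and red: "\<And>x. x < q * q * q \<Longrightarrow> reduced ((next_size ^^ R) 1) x (M' x)"
    using mr_run_prog[OF ok _ _ start, of R] pos pow2_def by (metis One_nat_def Suc_leI power_0)
  have size: "(next_size ^^ R) 1 = q"
    using R by (simp only: next_size_power) (simp add: q_def b_def min_absorb2)
  have "holds_result p S (\<lambda>x y. ((x div b * q + y div b) * q + (x mod b * b + y mod b) mod q,
        18 + 4 * ((x mod b * b + y mod b) div q))) (A \<star> B) M'"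
    unfolding holds_result_def
  proof (intro allI impI)
    fix x y assume "x < dim_row (A \<star> B)" "y < dim_col (A \<star> B)"
    then have xy: "x < n" "y < n" using A B by (auto simp: dist_prod_def)
    then have xy': "x < q * b" "y < q * b" using n(2) by (auto simp: q_def b_def)
    define s where "s = x mod b * b + y mod b"
    define z where "z = (x div b * q + y div b) * q + s mod q"
    have "s < (x mod b + 1) * b" using pos by (simp add: s_def)
    also have "\<dots> \<le> b * b" using pos by (intro mult_le_mono1) (simp add: Suc_le_eq)
    finally have s: "s < b * b" .
    have ij: "x div b < q" "y div b < q" using xy' by (simp_all add: less_mult_imp_div_less)
    have "x div b * q + y div b < (x div b + 1) * q" using ij by simp
    also have "\<dots> \<le> q * q" using ij by (intro mult_le_mono1) simp
    finally have ij': "x div b * q + y div b + 1 \<le> q * q" by simp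
    have "z < (x div b * q + y div b + 1) * q" using pos by (simp add: z_def)
    also have "\<dots> \<le> q * q * q" by (rule mult_le_mono1[OF ij'])
    finally have z: "z < q * q * q" .
    have "z mod q = s mod q" by (simp add: z_def)
    then have "M' z (18 + 4 * (s div q)) = Entry (group_min q z s)"
      using red[OF z] s unfolding size reduced_def by simp
    also have "group_min q z s = (MIN u\<in>{..<q * b}. a x u + c u y)"
      using group_min_entry[OF xy', of "s mod q"] pos by (simp add: z_def s_def)
    also have "\<dots> = (MIN k\<in>{..<n}. A $$ (x, k) + B $$ (k, y))"
    proof -
      have "(\<lambda>u. a x u + c u y) ` {..<q * b} = (\<lambda>k. A $$ (x, k) + B $$ (k, y)) ` (\<lambda>u. u mod n) ` {..<q * b}"
        using xy by (simp add: a_def c_def image_image)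
      also have "(\<lambda>u. u mod n) ` {..<q * b} = {..<n}"
        by (rule image_mod_lessThan) (use n in \<open>simp_all add: q_def b_def\<close>)
      finally show ?thesis by simp
    qed
    also have "\<dots> = (A \<star> B) $$ (x, y)" using xy A B by (auto simp: dist_prod_def)
    finally have "M' z (18 + 4 * (s div q)) = Entry ((A \<star> B) $$ (x, y))" .
    moreover have "s div q \<le> s" by simp
    then have "18 + 4 * (s div q) < S" using s mem unfolding b_def by linarith
    moreover have "z < p" using z q3 p8 by simp
    ultimately show "fst ((x div b * q + y div b) * q + (x mod b * b + y mod b) mod q,
        18 + 4 * ((x mod b * b + y mod b) div q)) < p \<and>
      snd ((x div b * q + y div b) * q + (x mod b * b + y mod b) mod q,
        18 + 4 * ((x mod b * b + y mod b) div q)) < S \<and>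
      M' (fst ((x div b * q + y div b) * q + (x mod b * b + y mod b) mod q,
        18 + 4 * ((x mod b * b + y mod b) div q)))
       (snd ((x div b * q + y div b) * q + (x mod b * b + y mod b) mod q,
        18 + 4 * ((x mod b * b + y mod b) div q))) = Entry ((A \<star> B) $$ (x, y))"
      by (simp only: fst_conv snd_conv s_def[symmetric] z_def[symmetric])
  qed
  with t show ?thesis by blast
qed

section \<open>Choice of the parameters\<close>

text \<open>Write \<open>q = 2 ^ \<alpha>\<close> and \<open>b = 2 ^ \<beta>\<close>. Comparing
  cubes, \<open>q\<close> is at most \<open>n / N\<close>, and by maximality
  \<open>n < 2 * q * N\<close>. If \<open>b > 1\<close>, minimality gives
  \<open>q * (b / 2) < n\<close>, hence \<open>b < 4 * N\<close>; conversely
  \<open>q * N \<le> n \<le> q * b\<close> gives \<open>N \<le> b\<close>.\<close>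

lemma grid_exponents:
  fixes n :: nat and \<epsilon> :: real
  assumes n: "1 \<le> n" and \<epsilon>: "0 < \<epsilon>" "\<epsilon> \<le> 2"
  defines "N \<equiv> real n powr (\<epsilon> / 2)" and "p \<equiv> nat \<lfloor>real n powr (3 * (1 - \<epsilon> / 2))\<rfloor>"
  obtains \<alpha> \<beta> :: nat where "8 ^ \<alpha> \<le> p" "p < 8 ^ Suc \<alpha>"
    "\<And>i. i < \<beta> \<Longrightarrow> 2 ^ \<alpha> * 2 ^ i < n" "n \<le> 2 ^ \<alpha> * 2 ^ \<beta>"
    "2 ^ \<alpha> * N \<le> n" "2 ^ \<beta> \<le> 4 * N" "N \<le> 2 ^ \<beta>" "real p * N ^ 3 \<le> real n ^ 3"
proof -
  define X where "X = real n powr (3 * (1 - \<epsilon> / 2))"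
  have N: "1 \<le> N" using n \<epsilon> by (simp add: N_def ge_one_powr_ge_zero)
  have "X = real n powr 3 / real n powr (\<epsilon> / 2 * 3)"
    unfolding X_def powr_diff[symmetric] by (simp add: algebra_simps)
  also have "real n powr (\<epsilon> / 2 * 3) = N ^ 3"
    using n by (simp add: N_def powr_power mult.commute)
  finally have X: "X = real n ^ 3 / N ^ 3" using n by simp
  have "1 \<le> X" using n \<epsilon> by (simp add: X_def ge_one_powr_ge_zero)
  then have p: "1 \<le> p" "real p \<le> X" "X < real p + 1"
    unfolding p_def X_def[symmetric] by linarith+
  have pN: "real p * N ^ 3 \<le> real n ^ 3" using p(2) N by (simp add: X field_simps)
  obtain \<alpha> where \<alpha>: "8 ^ \<alpha> \<le> p" "p < 8 ^ Suc \<alpha>"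
    using ex_power_ivl1[of 8 p] p(1) by auto
  have cube: "(8::real) ^ k = (2 ^ k) ^ 3" for k
    by (simp add: power3_eq_cube power_mult_distrib[symmetric])
  have qN: "2 ^ \<alpha> * N \<le> n"
  proof (rule power_le_imp_le_base)
    have "(8::real) ^ \<alpha> \<le> real p" using \<alpha>(1) by (metis of_nat_le_iff of_nat_numeral of_nat_power)
    then have "(8::real) ^ \<alpha> * N ^ 3 \<le> real p * N ^ 3" using N by (intro mult_right_mono) auto
    also note pN
    finally show "(2 ^ \<alpha> * N) ^ Suc 2 \<le> real n ^ Suc 2"
      by (simp only: cube power_mult_distrib eval_nat_numeral)
  qed simp
  have nq: "n < 2 * 2 ^ \<alpha> * N"
  proof (rule power_less_imp_less_base)
    \<comment> \<open>Integrality undoes the floor: a power of 8 above \<open>p\<close> is at least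
      \<open>p + 1\<close>, hence above the unrounded number of machines.\<close>
    have "real p + 1 \<le> (8::real) ^ Suc \<alpha>" using \<alpha>(2) by (metis Suc_leI of_nat_Suc of_nat_le_iff of_nat_numeral of_nat_power add.commute)
    then have "X < 8 ^ Suc \<alpha>" using p(3) by linarith
    then have "real n ^ 3 < 8 ^ Suc \<alpha> * N ^ 3" using N by (simp add: X field_simps)
    then show "real n ^ 3 < (2 * 2 ^ \<alpha> * N) ^ 3" by (simp add: cube power_mult_distrib)
  qed (use N in simp)
  define \<beta> where "\<beta> = (LEAST \<beta>. n \<le> 2 ^ \<alpha> * 2 ^ \<beta>)"
  have "n \<le> 2 ^ \<alpha> * 2 ^ n"
  proof -
    have "n \<le> 2 ^ n" by (simp add: less_imp_le)
    also have "(2::nat) ^ n \<le> 2 ^ \<alpha> * 2 ^ n" by simp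
    finally show ?thesis .
  qed
  then have \<beta>: "n \<le> 2 ^ \<alpha> * 2 ^ \<beta>" unfolding \<beta>_def by (rule LeastI)
  have \<beta>': "2 ^ \<alpha> * 2 ^ i < n" if "i < \<beta>" for i
    using not_less_Least[of i "\<lambda>i. n \<le> 2 ^ \<alpha> * 2 ^ i"] that by (simp add: \<beta>_def)
  have b_le: "2 ^ \<beta> \<le> 4 * N"
  proof (cases \<beta>)
    case 0 then show ?thesis using N by simp
  next
    case (Suc i)
    then have "real (2 ^ \<alpha> * 2 ^ i) < real n" using \<beta>'[of i] by (subst of_nat_less_iff) simp
    then have "2 ^ \<alpha> * 2 ^ i < real n" by simp
    also have "\<dots> < 2 ^ \<alpha> * (2 * N)" using nq by (simp add: mult_ac)
    finally have "2 ^ \<alpha> * 2 ^ i < 2 ^ \<alpha> * (2 * N)" .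
    then have "2 ^ i < 2 * N" by (rule mult_left_less_imp_less) simp
    then show ?thesis by (simp add: Suc)
  qed
  have "real n \<le> real (2 ^ \<alpha> * 2 ^ \<beta>)" using \<beta> by (subst of_nat_le_iff)
  then have "real n \<le> 2 ^ \<alpha> * 2 ^ \<beta>" by simp
  with qN have "2 ^ \<alpha> * N \<le> 2 ^ \<alpha> * 2 ^ \<beta>" by linarith
  then have b_ge: "N \<le> 2 ^ \<beta>" by (rule mult_left_le_imp_le) simp
  show thesis using that[OF \<alpha> \<beta>' \<beta> qN b_le b_ge pN] .
qed

text \<open>Apply \<open>ln y < y\<close> to \<open>y = real n powr (\<epsilon> / 2)\<close>. The
  base-2 logarithm costs a factor 2, because \<open>ln z \<le> z - 1\<close> at
  \<open>z = 1 / 2\<close> yields \<open>ln 2 \<ge> 1 / 2\<close>.\<close>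

lemma log_factor_bound:
  fixes n k :: nat and \<epsilon> :: real
  assumes n: "1 \<le> n" and \<epsilon>: "0 < \<epsilon>" and k: "2 ^ k \<le> 2 * n"
  shows "real k \<le> 1 + 4 / \<epsilon> * real n powr (\<epsilon> / 2)"
proof -
  have "real (2 ^ k) \<le> real (2 * n)" using k by (subst of_nat_le_iff)
  then have "ln (2 ^ k) \<le> ln (2 * real n)" using n by (subst ln_le_cancel_iff) auto
  then have "real k * ln 2 \<le> ln 2 + ln (real n)" using n by (simp add: ln_realpow ln_mult)
  then have "(real k - 1) * ln 2 \<le> ln (real n)" by (simp add: algebra_simps)
  moreover have "1 / 2 \<le> ln (2 :: real)" using ln_le_minus_one[of "1 / 2 :: real"] by (simp add: ln_div)
  then have "(real k - 1) * (1 / 2) \<le> (real k - 1) * ln 2" if "1 \<le> k"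
    using that by (intro mult_left_mono) auto
  moreover have "0 \<le> ln (real n)" using n by simp
  ultimately have 1: "real k \<le> 1 + 2 * ln (real n)" by (cases "1 \<le> k") auto
  have "\<epsilon> / 2 * ln (real n) = ln (real n powr (\<epsilon> / 2))" using n by (simp add: ln_powr)
  also have "\<dots> \<le> real n powr (\<epsilon> / 2)" using n by (intro less_imp_le[OF ln_less_self]) simp
  finally have "ln (real n) \<le> 2 / \<epsilon> * real n powr (\<epsilon> / 2)" using \<epsilon> by (simp add: field_simps)
  with 1 show ?thesis by simp
qed

theorem theorem5p1:
  shows "\<exists>(prog :: com) (\<kappa> :: nat) (C :: real). C > 0 \<and>
    (\<forall>(n :: nat) (\<epsilon> :: real). 1 \<le> n \<and> 0 < \<epsilon> \<and> \<epsilon> \<le> 2 \<longrightarrow>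
      (let p = nat \<lfloor>real n powr (3 * (1 - \<epsilon> / 2))\<rfloor>;
           S = nat \<lfloor>C * real n powr \<epsilon>\<rfloor>;
           W = (n + 1) ^ \<kappa>;
           R = 1 + nat \<lceil>(1 - \<epsilon> / 2) / \<epsilon>\<rceil>
       in \<exists>lay loc. valid_placement n p S W lay \<and>
         (\<forall>(A :: 'a :: linordered_ab_semigroup_add mat) (B :: 'a mat).
            A \<in> carrier_mat n n \<and> B \<in> carrier_mat n n \<longrightarrow>
            (\<exists>t M. mr_run p S W prog R (init_mem n p lay A B) t M \<and>
               holds_result p S loc (A \<star> B) M \<and>
               real t \<le> C * (1 / \<epsilon>) * real n ^ 3))))"
proof (intro exI[of _ distance_com] exI[of _ "24 :: nat"] exI[of _ "400000 :: real"] conjI allI impI)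
  fix n :: nat and \<epsilon> :: real
  assume "1 \<le> n \<and> 0 < \<epsilon> \<and> \<epsilon> \<le> 2"
  then have n: "1 \<le> n" and \<epsilon>: "0 < \<epsilon>" "\<epsilon> \<le> 2" by auto
  define p S W R where "p = nat \<lfloor>real n powr (3 * (1 - \<epsilon> / 2))\<rfloor>"
    and "S = nat \<lfloor>400000 * real n powr \<epsilon>\<rfloor>"
    and "W = (n + 1) ^ 24" and "R = nat \<lceil>(1 - \<epsilon> / 2) / \<epsilon>\<rceil>"
  define N where "N = real n powr (\<epsilon> / 2)"
  obtain \<alpha> \<beta> :: nat where p8: "8 ^ \<alpha> \<le> p" "p < 8 ^ Suc \<alpha>"
    and nb: "\<And>i. i < \<beta> \<Longrightarrow> 2 ^ \<alpha> * 2 ^ i < n" "n \<le> 2 ^ \<alpha> * 2 ^ \<beta>"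
    and qN: "2 ^ \<alpha> * N \<le> n" and bN: "2 ^ \<beta> \<le> 4 * N" "N \<le> 2 ^ \<beta>" and pN: "real p * N ^ 3 \<le> real n ^ 3"
    using grid_exponents[OF n \<epsilon>] unfolding p_def N_def by blast
  define q b :: nat where "q = 2 ^ \<alpha>" and "b = 2 ^ \<beta>"
  have N1: "1 \<le> N" using n \<epsilon> by (simp add: N_def ge_one_powr_ge_zero)
  have N2: "N ^ 2 = real n powr \<epsilon>" using n by (simp add: N_def powr_power)
  have Nn: "N \<le> n" using powr_mono[of "\<epsilon> / 2" 1 "real n"] n \<epsilon> by (simp add: N_def)
  have N3: "1 \<le> N ^ 3" "N \<le> N ^ 3" using N1 by (simp_all add: one_le_power self_le_power)
  have q_n: "q \<le> n"
  proof -
    have "2 ^ \<alpha> * 1 \<le> 2 ^ \<alpha> * N" using N1 by (intro mult_left_mono) auto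
    moreover have "real q = 2 ^ \<alpha>" by (simp add: q_def)
    ultimately have "real q \<le> real n" using qN by linarith
    then show ?thesis by (simp only: of_nat_le_iff)
  qed
  have qb: "q * b \<le> 2 * n"
  proof (cases \<beta>)
    case 0 then show ?thesis using q_n by (simp add: b_def)
  next
    case (Suc i) then show ?thesis using nb(1)[of i] by (simp add: q_def b_def)
  qed
  have q1: "1 \<le> q" "1 \<le> b" by (simp_all add: q_def b_def)
  have b_n: "b \<le> 2 * n" using qb q1 by (metis le_trans mult_le_mono1 nat_mult_1)
  have p_n: "p \<le> n ^ 3"
  proof -
    have "real p * 1 \<le> real p * N ^ 3" using N3 by (intro mult_left_mono) auto
    with pN have "real p \<le> real n ^ 3" by linarith
    then show ?thesis by (metis of_nat_le_iff of_nat_power)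
  qed
  \<comment> \<open>The exponent 24 is 21 + 3: as \<open>n + 1\<close> is at least 2, its 21st power
    absorbs the constant 400000, and a cube remains.\<close>
  have W: "400000 * n ^ 3 \<le> W"
  proof -
    have "(400000 :: nat) \<le> 2 ^ 21" by simp
    also have "\<dots> \<le> (n + 1) ^ 21" using n by (intro power_mono) auto
    finally have "400000 * n ^ 3 \<le> (n + 1) ^ 21 * (n + 1) ^ 3"
      by (intro mult_le_mono power_mono) auto
    then show ?thesis by (simp add: W_def flip: power_add)
  qed
  have n_pow: "n \<le> n ^ 3" "n ^ 2 \<le> n ^ 3" "1 \<le> n ^ 3" using n by (auto intro: self_le_power power_increasing)
  have bb: "b * b \<le> 4 * n ^ 2" using mult_le_mono[OF b_n b_n] by (simp add: power2_eq_square)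
  have qbb: "q * (b * b) \<le> 4 * n ^ 2"
    using mult_le_mono[OF qb b_n] by (simp add: power2_eq_square mult.assoc)
  have bbN: "real (b * b) \<le> 16 * N ^ 2"
    using power_mono[OF bN(1), of 2] by (simp add: b_def power2_eq_square)
  have mem: "20 + 8 * (b * b) \<le> S"
    unfolding S_def N2[symmetric]
  proof (rule le_nat_floor)
    have "1 \<le> N ^ 2" using N1 by (simp add: one_le_power)
    then show "real (20 + 8 * (b * b)) \<le> 400000 * N ^ 2" using bbN by simp
  qed
  have SW: "S \<le> W"
  proof -
    have "N ^ 2 \<le> real n ^ 2" using Nn N1 by (intro power_mono) auto
    moreover have "real S \<le> 400000 * N ^ 2" unfolding S_def N2[symmetric] by (rule of_nat_floor) simp
    moreover have "real (400000 * n ^ 2) = 400000 * real n ^ 2" by simp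
    ultimately have "real S \<le> real (400000 * n ^ 2)" by linarith
    then have "S \<le> 400000 * n ^ 2" by (simp only: of_nat_le_iff)
    with n_pow W show ?thesis by linarith
  qed
  have bounds: "8 * p + 8 \<le> W" "2 * n \<le> W" "q * (b * b) \<le> W" "q + b * b \<le> W"
    using W n_pow p_n qbb bb q_n by linarith+
  \<comment> \<open>Here rounding \<open>q\<close> down and \<open>b\<close> up pays off:
    \<open>q \<le> n / N\<close> and \<open>N ^ 2 \<le> b * b\<close> carry no constants, so exactly
    the claimed number of levels suffices.\<close>
  have qR: "q \<le> (b * b) ^ R"
  proof -
    have "(1 - \<epsilon> / 2) / \<epsilon> \<le> R" unfolding R_def by linarith
    then have "1 - \<epsilon> / 2 \<le> \<epsilon> * R" using \<epsilon> by (simp add: field_simps)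
    have "real q \<le> n / N" using qN N1 by (simp add: q_def field_simps)
    also have "\<dots> = real n powr (1 - \<epsilon> / 2)" using n by (simp add: N_def powr_diff)
    also have "\<dots> \<le> real n powr (\<epsilon> * R)" by (rule powr_mono[OF \<open>1 - \<epsilon> / 2 \<le> \<epsilon> * R\<close>]) (use n in simp)
    also have "\<dots> = (N ^ 2) ^ R" unfolding N2 using n by (simp add: powr_powr[symmetric] powr_realpow)
    also have "\<dots> \<le> (real (b * b)) ^ R"
      using power_mono[OF bN(2), of 2] N1 by (intro power_mono) (auto simp: b_def power2_eq_square)
    finally have "real q \<le> real ((b * b) ^ R)" by simp
    then show ?thesis by (subst (asm) of_nat_le_iff)
  qed
  \<comment> \<open>One constant serves for memory and time. Memory needs only 20 + 8 * 16 = 148.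
    Time needs 40 * 6 for the setup, 70 * 2 for its constant part, and 4 * 64030 for the rounds,
    where 64030 = 1000 * 4^3 + 30; together 256500.\<close>
  have time: "real (p * (40 * (\<alpha> + \<beta>) + 70) + Suc R * (p * (1000 * (b * (b * b)) + 30)))
      \<le> 400000 * (1 / \<epsilon>) * real n ^ 3"
  proof -
    define Y where "Y = real n ^ 3 / \<epsilon>"
    have n3: "real n ^ 3 \<le> 2 * Y" using \<epsilon> mult_right_mono[OF \<epsilon>(2), of "real n ^ 3"] by (simp add: Y_def field_simps)
    have p_le: "real p \<le> real n ^ 3"
    proof -
      have "real p \<le> real (n ^ 3)" using p_n by (subst of_nat_le_iff)
      then show ?thesis by simp
    qed
    have "2 ^ (\<alpha> + \<beta>) \<le> 2 * n" using qb by (simp add: q_def b_def power_add)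
    then have "real (\<alpha> + \<beta>) \<le> 1 + 4 / \<epsilon> * N" unfolding N_def by (rule log_factor_bound[OF n \<epsilon>(1)])
    also have "\<dots> \<le> 1 + 4 / \<epsilon> * N ^ 3" using N3 \<epsilon> by (intro add_left_mono mult_left_mono) auto
    finally have "real p * real (\<alpha> + \<beta>) \<le> real p * (1 + 4 / \<epsilon> * N ^ 3)" by (intro mult_left_mono) auto
    also have "\<dots> = real p + 4 / \<epsilon> * (real p * N ^ 3)" by (simp add: algebra_simps)
    also have "\<dots> \<le> real n ^ 3 + 4 / \<epsilon> * real n ^ 3"
      using p_le pN \<epsilon> by (intro add_mono mult_left_mono) auto
    also have "\<dots> \<le> 6 * Y" using n3 by (simp add: Y_def)
    finally have 1: "real p * real (\<alpha> + \<beta>) \<le> 6 * Y" .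
    have "real b ^ 3 \<le> (4 * N) ^ 3" using bN(1) by (intro power_mono) (auto simp: b_def)
    then have "real p * (1000 * real b ^ 3 + 30) \<le> real p * (64030 * N ^ 3)"
      using N3 by (intro mult_left_mono) (auto simp: power_mult_distrib)
    also have "\<dots> \<le> 64030 * real n ^ 3" using pN by simp
    finally have 2: "real p * (1000 * real b ^ 3 + 30) \<le> 64030 * real n ^ 3" .
    \<comment> \<open>The number of rounds is \<open>O(1 / \<epsilon>)\<close>; this contributes the
      factor \<open>1 / \<epsilon>\<close> for the rounds, and \<open>\<epsilon> \<le> 2\<close>
      absorbs the additive 3/2.\<close>
    have "0 \<le> (1 - \<epsilon> / 2) / \<epsilon>" using \<epsilon> by simp
    then have "real R \<le> (1 - \<epsilon> / 2) / \<epsilon> + 1" unfolding R_def by linarith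
    also have "\<dots> = 1 / \<epsilon> + 1 / 2" using \<epsilon> by (simp add: field_simps)
    finally have "real (Suc R) \<le> 1 / \<epsilon> + 3 / 2" by simp
    also have "\<dots> \<le> 4 / \<epsilon>" using \<epsilon> by (simp add: field_simps)
    finally have "real (Suc R) * (real p * (1000 * real b ^ 3 + 30)) \<le> 4 / \<epsilon> * (64030 * real n ^ 3)"
      by (rule mult_mono[OF _ 2]) (use \<epsilon> in auto)
    also have "\<dots> = 256120 * Y" by (simp add: Y_def)
    finally have 3: "real (Suc R) * (real p * (1000 * real b ^ 3 + 30)) \<le> 256120 * Y" .
    have "real (p * (40 * (\<alpha> + \<beta>) + 70) + Suc R * (p * (1000 * (b * (b * b)) + 30))) =
       40 * (real p * real (\<alpha> + \<beta>)) + 70 * real p + real (Suc R) * (real p * (1000 * real b ^ 3 + 30))"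
      by (simp add: algebra_simps power3_eq_cube)
    also have "\<dots> \<le> 400000 * Y" using 1 3 p_le n3 by linarith
    finally show ?thesis by (simp add: Y_def)
  qed
  have "valid_placement n p S W (block_placement n q b)"
    unfolding valid_placement_def
  proof (intro conjI allI impI)
    show "3 \<le> S" using mem by linarith
    show "n \<le> W" "p \<le> W" using bounds by linarith+
  next
    fix i a
    have "a < S" if "16 \<le> a" "(a - 16) div 4 < b * b"
    proof -
      have "a - 16 < 4 * (b * b)" using that(2) by (simp add: div_less_iff_less_mult mult.commute)
      with mem show ?thesis by linarith
    qed
    then show "case block_placement n q b i a of None \<Rightarrow> True
      | Some (FromA x y) \<Rightarrow> 3 \<le> a \<and> a < S \<and> x < n \<and> y < n
      | Some (FromB x y) \<Rightarrow> 3 \<le> a \<and> a < S \<and> x < n \<and> y < n"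
      using n by (simp add: block_placement_def Let_def)
  qed
  moreover have "\<exists>t M. mr_run p S W distance_com (1 + R) (init_mem n p (block_placement n q b) A B) t M \<and>
      holds_result p S (\<lambda>x y. ((x div b * q + y div b) * q + (x mod b * b + y mod b) mod q,
        18 + 4 * ((x mod b * b + y mod b) div q))) (A \<star> B) M \<and>
      real t \<le> 400000 * (1 / \<epsilon>) * real n ^ 3"
    if "A \<in> carrier_mat n n \<and> B \<in> carrier_mat n n" for A B :: "'a mat"
  proof -
    have "\<exists>t M. mr_run p S W distance_com (Suc R) (init_mem n p (block_placement n q b) A B) t M \<and>
      holds_result p S (\<lambda>x y. ((x div b * q + y div b) * q + (x mod b * b + y mod b) mod q,
        18 + 4 * ((x mod b * b + y mod b) div q))) (A \<star> B) M \<and>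
      t \<le> p * (40 * (\<alpha> + \<beta>) + 70) + Suc R * (p * (1000 * (b * (b * b)) + 30))"
      unfolding q_def b_def
      by (rule dist_prod_via_grid[where W = W])
         (use that n nb p8 mem SW bounds qR in \<open>simp_all add: q_def b_def\<close>)
    then obtain t M where "mr_run p S W distance_com (Suc R) (init_mem n p (block_placement n q b) A B) t M"
      "holds_result p S (\<lambda>x y. ((x div b * q + y div b) * q + (x mod b * b + y mod b) mod q,
        18 + 4 * ((x mod b * b + y mod b) div q))) (A \<star> B) M"
      "t \<le> p * (40 * (\<alpha> + \<beta>) + 70) + Suc R * (p * (1000 * (b * (b * b)) + 30))" by blast
    moreover from this(3) have "real t \<le> 400000 * (1 / \<epsilon>) * real n ^ 3"
      using time by (meson of_nat_le_iff le_trans order_trans)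
    ultimately show ?thesis by auto
  qed
  ultimately show "let p = nat \<lfloor>real n powr (3 * (1 - \<epsilon> / 2))\<rfloor>;
           S = nat \<lfloor>400000 * real n powr \<epsilon>\<rfloor>;
           W = (n + 1) ^ 24;
           R = 1 + nat \<lceil>(1 - \<epsilon> / 2) / \<epsilon>\<rceil>
       in \<exists>lay loc. valid_placement n p S W lay \<and>
         (\<forall>(A :: 'a mat) (B :: 'a mat).
            A \<in> carrier_mat n n \<and> B \<in> carrier_mat n n \<longrightarrow>
            (\<exists>t M. mr_run p S W distance_com R (init_mem n p lay A B) t M \<and>
               holds_result p S loc (A \<star> B) M \<and>
               real t \<le> 400000 * (1 / \<epsilon>) * real n ^ 3))"
    unfolding Let_def p_def[symmetric] S_def[symmetric] W_def[symmetric] R_def[symmetric] by blast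
qed simp

end
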